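(* Let $n\geq 3$ and let $(M^n,g)=(\mathbb R^n,\delta+df\otimes df)$ be the graph of a smooth asymptotically flat function $f:\mathbb R^n\to\mathbb R$ with the metric induced from $\mathbb R^{n+1}$, and suppose that its scalar curvature $R$ satisfies $|R(x)|=O(|x|^{-q})$ as $|x|\to\infty$ for some $q>n$. Let $m$ be the ADM mass of $(M^n,g)$, let $\nabla f$ be the gradient of $f$ in the flat metric and $|\nabla f|$ its norm with respect to the flat metric, and let $dV_g$ be the volume form of $(M^n,g)$. Then $$m=\frac{1}{2(n-1)\omega_{n-1}}\int_{M^n} R\,\frac{1}{\sqrt{1+|\nabla f|^2}}\,dV_g.$$ In particular, if $R\geq 0$ then $m\geq 0$.
   Context: Notation: $\delta$ is the flat Euclidean metric on $\mathbb R^n$; $f_i,f_{ij},f_{ijk}$ denote partial derivatives of $f$ in the standard coordinates; $\omega_{n-1}$ is the volume of the unit $(n-1)$-sphere in $\mathbb R^n$. Graph: the graph of $f$ with the metric induced from $\mathbb R^{n+1}$ is isometric to $(\mathbb R^n,\delta+df\otimes df)$, i.e. $g_{ij}=\delta_{ij}+f_if_j$, and is identified with it. Asymptotically flat function: a smooth $f:\mathbb R^n\to\mathbb R$ is asymptotically flat if for some $p>(n-2)/2$, as $|x|\to\infty$, $f_i(x)=O(|x|^{-p/2})$ and $|x||f_{ij}(x)|+|x|^2|f_{ijk}(x)|=O(|x|^{-p/2})$ for all $i,j,k$. ADM mass: $$m=\lim_{r\to\infty}\frac{1}{2(n-1)\omega_{n-1}}\int_{S_r}\sum_{i,j}(g_{ij,i}-g_{ii,j})\,\nu_j\,dS_r,$$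 where $g_{ij}$ are the components of $g$ in the standard coordinates of $\mathbb R^n$, commas denote partial derivatives, $S_r=\{|x|=r\}$, $\nu$ is the Euclidean outward unit normal to $S_r$, and $dS_r$ is the Euclidean area element of $S_r$. *)

theory Defs
  imports "HOL-Analysis.Analysis" "HOL-Library.Landau_Symbols"
begin

definition partial :: "'n::finite \<Rightarrow> (real^'n \<Rightarrow> real) \<Rightarrow> real^'n \<Rightarrow> real" where
  "partial i f x = deriv (\<lambda>t. f (x + t *\<^sub>R axis i 1)) 0"

primrec cont_diff :: "nat \<Rightarrow> (real^'n::finite \<Rightarrow> real) \<Rightarrow> bool" where
  "cont_diff 0 f \<longleftrightarrow> continuous_on UNIV f"
| "cont_diff (Suc k) f \<longleftrightarrow>
     (\<forall>x. f differentiable (at x)) \<and> (\<forall>i. cont_diff k (partial i f))"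

definition smooth :: "(real^'n::finite \<Rightarrow> real) \<Rightarrow> bool" where
  "smooth f \<longleftrightarrow> (\<forall>k. cont_diff k f)"

definition grad :: "(real^'n::finite \<Rightarrow> real) \<Rightarrow> real^'n \<Rightarrow> real^'n" where
  "grad f x = (\<chi> i. partial i f x)"

definition asymptotically_flat :: "(real^'n::finite \<Rightarrow> real) \<Rightarrow> bool" where
  "asymptotically_flat f \<longleftrightarrow>
     (\<exists>p > (real CARD('n) - 2) / 2.
        (\<forall>i. partial i f \<in> O[at_infinity](\<lambda>x. norm x powr (- p / 2))) \<and>
        (\<forall>i j k. (\<lambda>x. norm x * \<bar>partial j (partial i f) x\<bar>
                     + (norm x)\<^sup>2 * \<bar>partial k (partial j (partial i f)) x\<bar>)
                  \<in> O[at_infinity](\<lambda>x. norm x powr (- p / 2))))"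

type_synonym 'n metric_tensor = "real^'n \<Rightarrow> real^'n^'n"

text \<open>
  The graph of \<open>f\<close> with the metric induced from one dimension higher, pulled back along
  \<open>x \<mapsto> (x, f x)\<close>: this is \<open>\<delta> + df \<otimes> df\<close>.
\<close>
definition graph_metric :: "(real^'n::finite \<Rightarrow> real) \<Rightarrow> 'n metric_tensor" where
  "graph_metric f x = (\<chi> i j. (if i = j then 1 else 0) + partial i f x * partial j f x)"

definition christoffel :: "'n::finite metric_tensor \<Rightarrow> 'n \<Rightarrow> 'n \<Rightarrow> 'n \<Rightarrow> real^'n \<Rightarrow> real" where
  "christoffel g k i j x =
     (1/2) * (\<Sum>l\<in>UNIV. matrix_inv (g x) $ k $ l *
        (partial i (\<lambda>y. g y $ j $ l) x + partial j (\<lambda>y. g y $ i $ l) x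
         - partial l (\<lambda>y. g y $ i $ j) x))"

text \<open>
  \<open>riemann g l k i j\<close> is the \<open>\<partial>\<^sub>l\<close>-component of \<open>R(\<partial>\<^sub>i, \<partial>\<^sub>j) \<partial>\<^sub>k\<close>, where
  \<open>R(X,Y) = \<nabla>\<^sub>X \<nabla>\<^sub>Y - \<nabla>\<^sub>Y \<nabla>\<^sub>X - \<nabla>\<^bsub>[X,Y]\<^esub>\<close>; contracting \<open>l\<close> with \<open>i\<close> gives the Ricci tensor, with
  the sign for which round spheres have positive curvature.
\<close>
definition riemann :: "'n::finite metric_tensor \<Rightarrow> 'n \<Rightarrow> 'n \<Rightarrow> 'n \<Rightarrow> 'n \<Rightarrow> real^'n \<Rightarrow> real" where
  "riemann g l k i j x =
     partial i (christoffel g l j k) x - partial j (christoffel g l i k) x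
     + (\<Sum>s\<in>UNIV. christoffel g l i s x * christoffel g s j k x
                  - christoffel g l j s x * christoffel g s i k x)"

definition ricci :: "'n::finite metric_tensor \<Rightarrow> 'n \<Rightarrow> 'n \<Rightarrow> real^'n \<Rightarrow> real" where
  "ricci g j k x = (\<Sum>i\<in>UNIV. riemann g i k i j x)"

definition scalar_curvature :: "'n::finite metric_tensor \<Rightarrow> real^'n \<Rightarrow> real" where
  "scalar_curvature g x = (\<Sum>j\<in>UNIV. \<Sum>k\<in>UNIV. matrix_inv (g x) $ j $ k * ricci g j k x)"

definition riemannian_volume :: "'n::finite metric_tensor \<Rightarrow> (real^'n) measure" where
  "riemannian_volume g = density lborel (\<lambda>x. ennreal (sqrt (det (g x))))"

text \<open>
  Euclidean area on the sphere of radius \<open>r\<close> about \<open>0\<close> (for \<open>r > 0\<close>), as a Borel measure on the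
  ambient space concentrated on that sphere. The area of a subset \<open>A\<close> of the unit sphere is \<open>n\<close>
  times the volume of the cone \<open>{t *\<^sub>R a | t a. 0 < t \<and> t \<le> 1 \<and> a \<in> A}\<close>; the radius \<open>r\<close> scales area
  by \<open>r ^ (n - 1)\<close>. The origin is removed only because it has no radial projection.
\<close>
definition sphere_area :: "real \<Rightarrow> 'a::euclidean_space measure" where
  "sphere_area r =
     scale_measure (ennreal (real DIM('a) * r ^ (DIM('a) - 1)))
       (distr (restrict_space lborel (cball 0 1 - {0})) borel (\<lambda>x. (r / norm x) *\<^sub>R x))"

definition unit_sphere_volume :: "'a::euclidean_space itself \<Rightarrow> real" where
  "unit_sphere_volume _ = measure (sphere_area 1 :: 'a measure) (sphere 0 1)"

definition adm_flux :: "'n::finite metric_tensor \<Rightarrow> real \<Rightarrow> real" where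
  "adm_flux g r =
     1 / (2 * (real CARD('n) - 1) * unit_sphere_volume TYPE(real^'n)) *
     (LINT x|sphere_area r. (\<Sum>i\<in>UNIV. \<Sum>j\<in>UNIV.
        (partial i (\<lambda>y. g y $ i $ j) x - partial j (\<lambda>y. g y $ i $ i) x) * (x $ j / norm x)))"

(* Unspecified if the limit does not exist; use together with convergence of adm_flux. *)
definition adm_mass :: "'n::finite metric_tensor \<Rightarrow> real" where
  "adm_mass g = Lim at_top (adm_flux g)"

lemma sphere_area_sphere:
  assumes "r > 0"
  shows "measure (sphere_area r :: 'a::euclidean_space measure) (sphere 0 r)
           = real DIM('a) * unit_ball_vol (real DIM('a)) * r ^ (DIM('a) - 1)"
proof -
  have m: "(\<lambda>x::'a. (r / norm x) *\<^sub>R x) \<in> restrict_space lborel (cball 0 1 - {0}) \<rightarrow>\<^sub>M borel"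
    by (rule measurable_restrict_space1) simp
  have v: "(\<lambda>x::'a. (r / norm x) *\<^sub>R x) -` sphere 0 r \<inter> (cball 0 1 - {0}) = cball 0 1 - {0}"
    using assms by auto
  have "measure (distr (restrict_space lborel (cball 0 1 - {0})) borel
          (\<lambda>x::'a. (r / norm x) *\<^sub>R x)) (sphere 0 r)
        = measure lborel (cball 0 1 - {0::'a})"
    by (subst measure_distr[OF m]) (simp_all add: v space_restrict_space measure_restrict_space)
  also have "\<dots> = measure lborel (cball 0 1 :: 'a set)"
    by (intro measure_Diff_null_set) (auto simp: null_sets_def)
  also have "\<dots> = unit_ball_vol (real DIM('a))"
    by (simp add: content_cball)
  finally show ?thesis
    using assms by (simp add: sphere_area_def measure_def mult_ac enn2real_mult)
qed

end

theory Submission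
  imports Defs
begin

text \<open>
  Write \<open>w = 1 + \<bar>\<nabla>f\<bar>\<^sup>2\<close>. The scalar curvature of a graph is a divergence for the flat structure: \<open>R =
  div V\<close> with \<open>V = (\<Delta>f \<nabla>f - Hess f \<nabla>f) / w\<close> (\<open>scalar_curvature_graph_metric\<close>). On the other hand, the
  integrand \<open>\<Sum>\<^sub>i (\<partial>\<^sub>i g\<^sub>i\<^sub>j - \<partial>\<^sub>j g\<^sub>i\<^sub>i)\<close> of the ADM mass is \<open>\<Delta>f \<nabla>f - Hess f \<nabla>f = w V\<close>
  (\<open>adm_integrand_eq\<close>). The two fields differ by \<open>\<bar>\<nabla>f\<bar>\<^sup>2 V\<close>, and asymptotic flatness makes this \<open>O(r
  powr (- 2 p - 1))\<close> with \<open>2 p > n - 2\<close>, so that its integral over a sphere of area \<open>O(r ^ (n - 1))\<close>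
  tends to zero. The divergence theorem therefore gives the flux through a large sphere as the integral
  of \<open>R\<close> over the ball up to an error tending to zero. Since \<open>R\<close> is continuous and decays faster than
  \<open>\<bar>x\<bar> powr - n\<close>, it is integrable, and the ball integrals converge to the integral of \<open>R\<close> against
  Lebesgue measure. The volume form of the graph is \<open>sqrt w dx\<close>, because the determinant of \<open>\<delta> + df \<otimes>
  df\<close> is \<open>w\<close>; so this is the integral of \<open>R / sqrt w\<close> over the graph.

  The analytic half rests on surface integrals for the measure \<open>sphere_area\<close>. Its description by radial
  projection shows that the derivative of a ball integral with respect to the radius is the surface
  integral (\<open>DERIV_integral_cball\<close>). The divergence theorem on balls (\<open>divergence_theorem_ball\<close>) is
  deduced from this and from the fact that derivatives of compactly supported functions integrate to
  zero.
\<close>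

section \<open>Partial derivatives\<close>

text \<open>
  Existence of the partial derivative at every point, together with its values. Unlike \<open>partial\<close>, which
  is total, this relation is closed under the usual rules without side conditions on differentiability.
\<close>

definition has_partial :: "'n::finite \<Rightarrow> (real^'n \<Rightarrow> real) \<Rightarrow> (real^'n \<Rightarrow> real) \<Rightarrow> bool" where
  "has_partial i f f' \<longleftrightarrow> (\<forall>x. ((\<lambda>t. f (x + t *\<^sub>R axis i 1)) has_real_derivative f' x) (at 0))"

lemma DERIV_line_shift:
  fixes \<phi> :: "'a::real_normed_vector \<Rightarrow> real"
  assumes "\<And>x. ((\<lambda>t. \<phi> (x + t *\<^sub>R e)) has_real_derivative \<phi>' x) (at 0)"
  shows "((\<lambda>t. \<phi> (x + t *\<^sub>R e)) has_real_derivative \<phi>' (x + t *\<^sub>R e)) (at t)"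
proof -
  have "((\<lambda>s. \<phi> (x + (s + t) *\<^sub>R e)) has_real_derivative \<phi>' (x + t *\<^sub>R e)) (at 0)"
    using assms[of "x + t *\<^sub>R e"] by (simp add: scaleR_add_left add_ac)
  then show ?thesis
    using DERIV_shift[of "\<lambda>t. \<phi> (x + t *\<^sub>R e)" "\<phi>' (x + t *\<^sub>R e)" 0 t] by simp
qed

lemma partial_eq: "has_partial i f f' \<Longrightarrow> partial i f = f'"
  by (auto simp: has_partial_def partial_def DERIV_imp_deriv)

lemma has_partial_const: "has_partial i (\<lambda>_. c) (\<lambda>_. 0)"
  by (simp add: has_partial_def)

lemma has_partial_add:
  "has_partial i f f' \<Longrightarrow> has_partial i g g' \<Longrightarrow> has_partial i (\<lambda>x. f x + g x) (\<lambda>x. f' x + g' x)"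
  unfolding has_partial_def by (auto intro!: derivative_eq_intros)

lemma has_partial_diff:
  "has_partial i f f' \<Longrightarrow> has_partial i g g' \<Longrightarrow> has_partial i (\<lambda>x. f x - g x) (\<lambda>x. f' x - g' x)"
  unfolding has_partial_def by (auto intro!: derivative_eq_intros)

lemma has_partial_mult:
  assumes "has_partial i f f'" "has_partial i g g'"
  shows "has_partial i (\<lambda>x. f x * g x) (\<lambda>x. f' x * g x + f x * g' x)"
  unfolding has_partial_def
proof
  fix x
  from DERIV_mult[OF assms(1)[unfolded has_partial_def, rule_format] assms(2)[unfolded has_partial_def,
      rule_format]]
  show "((\<lambda>t. f (x + t *\<^sub>R axis i 1) * g (x + t *\<^sub>R axis i 1)) has_real_derivative f' x * g x + f x *
      g' x) (at 0)"
    by (rule DERIV_cong) (simp add: mult.commute)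
qed

lemma has_partial_divide:
  assumes "has_partial i f f'" "has_partial i g g'" and "\<And>x. g x \<noteq> 0"
  shows "has_partial i (\<lambda>x. f x / g x) (\<lambda>x. f' x / g x - f x * g' x / (g x)\<^sup>2)"
  unfolding has_partial_def
proof
  fix x
  from DERIV_divide[OF assms(1)[unfolded has_partial_def, rule_format] assms(2)[unfolded
      has_partial_def, rule_format] assms(3)]
  show "((\<lambda>t. f (x + t *\<^sub>R axis i 1) / g (x + t *\<^sub>R axis i 1)) has_real_derivative f' x / g x - f x *
      g' x / (g x)\<^sup>2) (at 0)"
    by (rule DERIV_cong) (use assms(3)[of x] in \<open>simp add: power2_eq_square diff_divide_distrib\<close>)
qed

lemma has_partial_sum:
  "(\<And>k. k \<in> A \<Longrightarrow> has_partial i (f k) (f' k)) \<Longrightarrow> has_partial i (\<lambda>x. \<Sum>k\<in>A. f k x) (\<lambda>x. \<Sum>k\<in>A. f' k x)"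
  unfolding has_partial_def by (auto intro!: derivative_eq_intros)

lemmas has_partial_intros = has_partial_const has_partial_add has_partial_diff has_partial_mult
  has_partial_divide has_partial_sum

lemma has_partial_line:
  assumes "has_partial i f f'"
  shows "((\<lambda>t. f (x + t *\<^sub>R axis i 1)) has_real_derivative f' (x + t *\<^sub>R axis i 1)) (at t)"
  by (rule DERIV_line_shift[OF assms[unfolded has_partial_def, rule_format]])

text \<open>
  Symmetry of second derivatives: on the segment from \<open>y\<close> in direction \<open>i\<close>, the increment of \<open>f\<close> is the
  integral of \<open>fi\<close>. Differentiating under the integral in direction \<open>j\<close> expresses the increment of \<open>fj\<close>
  as the integral of \<open>fji\<close>, and the fundamental theorem of calculus recovers \<open>fji\<close> as its derivative.
\<close>

lemma has_partial_commute:
  fixes f :: "real^'n::finite \<Rightarrow> real"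
  assumes fi: "has_partial i f fi" and fj: "has_partial j f fj" and fji: "has_partial j fi fji"
    and cont: "continuous_on UNIV fi" "continuous_on UNIV fji"
  shows "has_partial i fj fji"
  unfolding has_partial_def
proof
  fix x :: "real^'n"
  define a :: "real^'n" where "a = axis i 1"
  define b :: "real^'n" where "b = axis j 1"
  \<comment> \<open>Starting one unit before \<open>x\<close> puts \<open>x\<close> in the interior of the segment, so the derivative is two-sided.\<close>
  define y where "y = x - a"
  have key: "fj (y + s *\<^sub>R a) = fj y + integral {0..s} (\<lambda>\<sigma>. fji (y + \<sigma> *\<^sub>R a))" if s: "s \<in> {0..2}" for s
  proof -
    have FTC: "f (y + t *\<^sub>R b + s *\<^sub>R a) = f (y + t *\<^sub>R b) + integral (cbox 0 s) (\<lambda>\<sigma>. fi (y + \<sigma> *\<^sub>R a +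
        t *\<^sub>R b))" for t
    proof -
      have "((\<lambda>\<sigma>. fi (y + t *\<^sub>R b + \<sigma> *\<^sub>R a)) has_integral (f (y + t *\<^sub>R b + s *\<^sub>R a) - f (y + t *\<^sub>R b +
          0 *\<^sub>R a))) {0..s}"
        using s has_partial_line[OF fi, folded a_def]
        by (intro fundamental_theorem_of_calculus)
           (auto simp: has_real_derivative_iff_has_vector_derivative[symmetric] intro: DERIV_subset)
      then show ?thesis by (simp add: integral_unique add_ac)
    qed
    have "((\<lambda>t. integral (cbox 0 s) (\<lambda>\<sigma>. fi (y + \<sigma> *\<^sub>R a + t *\<^sub>R b))) has_field_derivative
       integral (cbox 0 s) (\<lambda>\<sigma>. fji (y + \<sigma> *\<^sub>R a + 0 *\<^sub>R b))) (at 0 within UNIV)"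
    proof (rule leibniz_rule_field_derivative)
      show "((\<lambda>t. fi (y + \<sigma> *\<^sub>R a + t *\<^sub>R b)) has_field_derivative fji (y + \<sigma> *\<^sub>R a +
          t *\<^sub>R b)) (at t within UNIV)" for t \<sigma>
        using has_partial_line[OF fji, folded b_def] by simp
      show "(\<lambda>\<sigma>. fi (y + \<sigma> *\<^sub>R a + t *\<^sub>R b)) integrable_on cbox 0 s" for t
        by (intro integrable_continuous continuous_on_compose2[OF cont(1)] continuous_intros) auto
      show "continuous_on (UNIV \<times> cbox 0 s) (\<lambda>(t, \<sigma>). fji (y + \<sigma> *\<^sub>R a + t *\<^sub>R b))"
        unfolding split_beta by (intro continuous_on_compose2[OF cont(2)] continuous_intros) auto
    qed auto
    moreover have "((\<lambda>t. f (y + t *\<^sub>R b)) has_field_derivative fj y) (at 0)"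
      using has_partial_line[OF fj, folded b_def, of y 0] by simp
    ultimately have "((\<lambda>t. f (y + t *\<^sub>R b + s *\<^sub>R a)) has_field_derivative fj y +
        integral (cbox 0 s) (\<lambda>\<sigma>. fji (y + \<sigma> *\<^sub>R a))) (at 0)"
      unfolding FTC by (intro DERIV_add) auto
    moreover have "((\<lambda>t. f (y + t *\<^sub>R b + s *\<^sub>R a)) has_field_derivative fj (y + s *\<^sub>R a)) (at 0)"
      using has_partial_line[OF fj, folded b_def, of "y + s *\<^sub>R a" 0] by (simp add: add_ac)
    ultimately show ?thesis using DERIV_unique by fastforce
  qed
  have "((\<lambda>s. integral {0..s} (\<lambda>\<sigma>. fji (y + \<sigma> *\<^sub>R a))) has_real_derivative fji (y +
      1 *\<^sub>R a)) (at 1 within {0..2})"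
    by (intro integral_has_real_derivative continuous_on_compose2[OF cont(2)] continuous_intros) auto
  then have "((\<lambda>s. fj y + integral {0..s} (\<lambda>\<sigma>. fji (y + \<sigma> *\<^sub>R a))) has_real_derivative fji x) (at 1)"
    by (auto intro!: derivative_eq_intros simp: y_def at_within_Icc_at)
  then have "((\<lambda>s. fj (y + s *\<^sub>R a)) has_real_derivative fji x) (at 1)"
    by (rule has_field_derivative_transform_within_open[where S="{0<..<2}"]) (auto simp: key)
  then have "((\<lambda>s. fj (y + (s + 1) *\<^sub>R a)) has_real_derivative fji x) (at 0)"
    using DERIV_shift[of "\<lambda>s. fj (y + s *\<^sub>R a)" "fji x" 0 1] by simp
  then show "((\<lambda>t. fj (x + t *\<^sub>R axis i 1)) has_real_derivative fji x) (at 0)"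
    by (simp add: y_def a_def scaleR_add_left)
qed

lemma cont_diff_imp_continuous: "cont_diff k f \<Longrightarrow> continuous_on UNIV f"
  by (cases k) (auto simp: continuous_on_eq_continuous_at differentiable_imp_continuous_within)

lemma differentiable_has_partial:
  fixes f :: "real^'n::finite \<Rightarrow> real"
  assumes "\<And>x. f differentiable (at x)"
  shows "has_partial i f (partial i f)"
  unfolding has_partial_def
proof
  fix x :: "real^'n"
  have "(\<lambda>t. f (x + t *\<^sub>R axis i 1)) differentiable (at (0::real))"
  proof (rule differentiable_chain_at[where f="\<lambda>t. x + t *\<^sub>R axis i 1" and g=f, unfolded o_def])
    show "(\<lambda>t. x + t *\<^sub>R axis i 1) differentiable (at (0::real))"
      by (intro derivative_intros)
  qed (rule assms)
  then show "((\<lambda>t. f (x + t *\<^sub>R axis i 1)) has_real_derivative partial i f x) (at 0)"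
    unfolding partial_def
    using DERIV_imp_deriv by (metis real_differentiable_def)
qed

lemma smooth_partial: "smooth f \<Longrightarrow> smooth (partial i f)"
  unfolding smooth_def by (metis cont_diff.simps(2))

lemma smooth_continuous: "smooth f \<Longrightarrow> continuous_on UNIV f"
  unfolding smooth_def using cont_diff_imp_continuous by blast

lemma smooth_has_partial: "smooth f \<Longrightarrow> has_partial i f (partial i f)"
  unfolding smooth_def by (intro differentiable_has_partial) (metis cont_diff.simps(2))

lemma smooth_partial_commute: "smooth f \<Longrightarrow> partial i (partial j f) = partial j (partial i f)"
  by (intro partial_eq has_partial_commute[of i f "partial i f" j "partial j f"] smooth_has_partial
      smooth_continuous smooth_partial)

section \<open>The scalar curvature of a graph\<close>

lemma matrix_inv_eqI:
  fixes A B :: "real^'n^'n"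
  assumes "A ** B = mat 1"
  shows "matrix_inv A = B"
proof -
  have BA: "B ** A = mat 1" using assms by (simp add: matrix_left_right_inverse)
  have "A ** matrix_inv A = mat 1 \<and> matrix_inv A ** A = mat 1"
    unfolding matrix_inv_def by (rule someI[of _ B]) (use assms BA in simp)
  then show ?thesis
    by (metis BA matrix_mul_assoc matrix_mul_lid matrix_mul_rid)
qed

definition rank_one_update :: "real^'n::finite \<Rightarrow> real^'n^'n" where
  "rank_one_update v = (\<chi> i j. (if i = j then 1 else 0) + v $ i * v $ j)"

lemma one_plus_inner_pos: "0 < 1 + v \<bullet> (v :: 'a::real_inner)"
  by (simp add: add_pos_nonneg)

text \<open>
  The Sherman--Morrison formula for a rank-one perturbation of the identity.
\<close>

lemma matrix_inv_rank_one_update: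
  fixes v :: "real^'n::finite"
  shows "matrix_inv (rank_one_update v) = (\<chi> i j. (if i = j then 1 else 0) - v $ i * v $ j / (1 + v \<bullet> v))"
proof (rule matrix_inv_eqI)
  define c where "c = 1 + v \<bullet> v"
  have c: "c \<noteq> 0" unfolding c_def using one_plus_inner_pos[of v] by simp
  have v2: "(\<Sum>k\<in>UNIV. v $ k * v $ k) = c - 1" by (simp add: c_def inner_vec_def)
  have "(\<Sum>k\<in>UNIV. ((if i = k then 1 else 0) + v $ i * v $ k) * ((if k = j then 1 else 0) - v $ k * v $ j
      / c)) = (if i = j then 1 else 0)" for i j
  proof -
    define d where "d = v $ i * v $ j / c"
    have "((if i = k then 1 else 0) + v $ i * v $ k) * ((if k = j then 1 else 0) - v $ k * v $ j / c) =
      (if i = k then if k = j then 1 else 0 else 0) - (if i = k then v $ k * v $ j / c else 0)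
        + (if k = j then v $ i * v $ k else 0) - d * (v $ k * v $ k)" for k
      by (simp add: d_def algebra_simps)
    then have "(\<Sum>k\<in>UNIV. ((if i = k then 1 else 0) + v $ i * v $ k) * ((if k = j then 1 else 0) - v $ k
        * v $ j / c)) =
      (if i = j then 1 else 0) - v $ i * v $ j / c + v $ i * v $ j - d * (c - 1)"
      by (simp add: sum.distrib sum_subtractf sum_distrib_left[symmetric] v2)
    also have "\<dots> = (if i = j then 1 else 0)" using c by (simp add: d_def field_simps)
    finally show ?thesis .
  qed
  then show "rank_one_update v ** (\<chi> i j. (if i = j then 1 else 0) - v $ i * v $ j / (1 + v \<bullet> v)) = mat 1"
    by (simp add: rank_one_update_def matrix_matrix_mult_def mat_def vec_eq_iff c_def)
qed

text \<open>
  In an orthonormal basis whose \<open>k\<close>-th vector points along \<open>v\<close> the matrix is diagonal, with entries \<open>1 +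
  \<bar>v\<bar>\<^sup>2\<close> (once) and \<open>1\<close>.
\<close>

lemma det_rank_one_update:
  fixes v :: "real^'n::finite"
  shows "det (rank_one_update v) = 1 + v \<bullet> v"
proof (cases "v = 0")
  case True
  then have "rank_one_update v = mat 1" by (simp add: rank_one_update_def mat_def vec_eq_iff)
  with True show ?thesis by simp
next
  case False
  define k :: 'n where "k = undefined"
  define s where "s = norm v"
  have s: "s \<noteq> 0" using False by (simp add: s_def)
  have "norm (v /\<^sub>R s) = 1" using s by (simp add: s_def)
  then obtain A where A: "orthogonal_matrix A" "A *v axis k 1 = v /\<^sub>R s"
    using orthogonal_matrix_exists_basis by blast
  have col: "A $ i $ k = v $ i / s" for i
  proof -
    have "(A *v axis k 1) $ i = A $ i $ k"
      by (simp add: matrix_vector_mult_def axis_def if_distrib cong: if_cong)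
    then show ?thesis by (simp add: A(2) divide_inverse mult.commute)
  qed
  define D :: "real^'n^'n" where "D = (\<chi> i j. if i = j then (if i = k then 1 + s * s else 1) else 0)"
  have AAT: "(\<Sum>m\<in>UNIV. A $ i $ m * A $ j $ m) = (if i = j then 1 else 0)" for i j
  proof -
    have "(A ** transpose A) $ i $ j = (mat 1 :: real^'n^'n) $ i $ j" using A(1)
        by (simp add: orthogonal_matrix_def)
    then show ?thesis by (simp add: matrix_matrix_mult_def transpose_def mat_def)
  qed
  have "A ** D ** transpose A = rank_one_update v"
  proof -
    have AD: "(A ** D) $ i $ j = A $ i $ j * (if j = k then 1 + s * s else 1)" for i j
      by (simp add: matrix_matrix_mult_def D_def if_distrib cong: if_cong)
    have "(\<Sum>m\<in>UNIV. A $ i $ m * (if m = k then 1 + s * s else 1) * A $ j $ m) =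
      (if i = j then 1 else 0) + v $ i * v $ j" for i j
    proof -
      have "A $ i $ m * (if m = k then 1 + s * s else 1) * A $ j $ m =
         A $ i $ m * A $ j $ m + (if m = k then s * s * (A $ i $ m * A $ j $ m) else 0)" for m
        by (simp add: algebra_simps)
      then show ?thesis using s by (simp add: sum.distrib AAT col)
    qed
    then show ?thesis
      by (simp add: vec_eq_iff matrix_matrix_mult_def[of "A ** D"] AD transpose_def rank_one_update_def)
  qed
  then have "det (rank_one_update v) = det A * det D * det (transpose A)"
    by (metis det_mul)
  also have "\<dots> = det D"
    using det_orthogonal_matrix[OF A(1)] by (auto simp: det_transpose)
  also have "det D = (\<Prod>i\<in>UNIV. if i = k then 1 + s * s else 1)"
    by (subst det_diagonal) (simp_all add: D_def)
  also have "\<dots> = 1 + v \<bullet> v" by (simp add: s_def dot_square_norm power2_eq_square)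
  finally show ?thesis .
qed

lemma graph_metric_eq: "graph_metric f x = rank_one_update (grad f x)"
  by (simp add: graph_metric_def rank_one_update_def grad_def)

lemma norm_grad: "(norm (grad f x))\<^sup>2 = (\<Sum>s\<in>UNIV. partial s f x * partial s f x)"
  by (simp add: power2_norm_eq_inner inner_vec_def grad_def)

lemma partial_graph_metric:
  assumes f: "smooth f"
  shows "partial i (\<lambda>y. graph_metric f y $ j $ l) x =
    partial i (partial j f) x * partial l f x + partial j f x * partial i (partial l f) x"
proof -
  have "has_partial i (\<lambda>y. graph_metric f y $ j $ l)
     (\<lambda>y. 0 + (partial i (partial j f) y * partial l f y + partial j f y * partial i (partial l f) y))"
    unfolding graph_metric_def vec_lambda_beta
        by (intro has_partial_intros smooth_has_partial smooth_partial f)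
  from partial_eq[OF this] show ?thesis by simp
qed

text \<open>
  The combination of first derivatives of the metric collapses to \<open>2 f\<^sub>i\<^sub>j f\<^sub>l\<close> by symmetry of the
  Hessian, and the inverse metric sends \<open>\<nabla>f\<close> to \<open>\<nabla>f / (1 + \<bar>\<nabla>f\<bar>\<^sup>2)\<close>.
\<close>

lemma christoffel_graph_metric:
  fixes f :: "real^'n::finite \<Rightarrow> real"
  assumes f: "smooth f"
  shows "christoffel (graph_metric f) k i j =
    (\<lambda>x. partial i (partial j f) x * partial k f x / (1 + (\<Sum>s\<in>UNIV. partial s f x * partial s f x)))"
proof
  fix x
  define a where "a k = partial k f x" for k
  define h where "h i j = partial i (partial j f) x" for i j
  define w where "w = 1 + (\<Sum>s\<in>UNIV. a s * a s)"
  have w: "w > 0" unfolding w_def by (intro add_pos_nonneg sum_nonneg) auto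
  have h_sym: "h i j = h j i" for i j
    unfolding h_def using smooth_partial_commute[OF f] by metis
  have inv: "matrix_inv (graph_metric f x) $ k $ l = (if k = l then 1 else 0) - a k * a l / w" for l
    unfolding graph_metric_eq matrix_inv_rank_one_update
    by (simp add: grad_def a_def w_def inner_vec_def)
  have dg: "partial i (\<lambda>y. graph_metric f y $ j $ l) x = h i j * a l + a j * h i l" for i j l
    by (simp add: partial_graph_metric[OF f] a_def h_def)
  have dg_sum: "h i j * a l + a j * h i l + (h j i * a l + a i * h j l) - (h l i * a j + a i * h l j) =
      2 * h i j * a l" for l
    unfolding h_sym[of j i] h_sym[of l i] h_sym[of l j] by (simp add: algebra_simps)
  have "christoffel (graph_metric f) k i j x =
     1/2 * (\<Sum>l\<in>UNIV. ((if k = l then 1 else 0) - a k * a l / w) * (2 * h i j * a l))"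
    unfolding christoffel_def inv dg dg_sum ..
  also have "\<dots> = (\<Sum>l\<in>UNIV. (if k = l then h i j * a l else 0) - h i j * a k / w * (a l * a l))"
    unfolding sum_distrib_left by (intro sum.cong refl) (simp add: algebra_simps)
  also have "\<dots> = h i j * a k - h i j * a k / w * (\<Sum>l\<in>UNIV. a l * a l)"
    unfolding sum_subtractf sum_distrib_left[symmetric] by simp
  also have "\<dots> = h i j * a k - h i j * a k / w * (w - 1)"
    by (simp add: w_def)
  also have "\<dots> = h i j * a k / w" using w by (simp add: field_simps)
  finally show "christoffel (graph_metric f) k i j x = partial i (partial j f) x * partial k f x / (1 +
      (\<Sum>s\<in>UNIV. partial s f x * partial s f x))"
    by (simp add: a_def h_def w_def)
qed

text \<open>
  The components of \<open>(\<Delta>f \<nabla>f - Hess f \<nabla>f) / (1 + \<bar>\<nabla>f\<bar>\<^sup>2)\<close>. Its divergence is the scalar curvature of the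
  graph, and \<open>1 + \<bar>\<nabla>f\<bar>\<^sup>2\<close> times it is the field whose flux defines the ADM mass.
\<close>

definition curvature_field :: "(real^'n::finite \<Rightarrow> real) \<Rightarrow> 'n \<Rightarrow> real^'n \<Rightarrow> real" where
  "curvature_field f j x = (\<Sum>i\<in>UNIV. partial i (partial i f) x * partial j f x -
      partial i (partial j f) x * partial i f x)
     / (1 + (\<Sum>s\<in>UNIV. partial s f x * partial s f x))"

lemma has_partial_one_plus_norm_grad:
  assumes f: "smooth f"
  shows "has_partial l (\<lambda>x. 1 + (\<Sum>s\<in>UNIV. partial s f x * partial s f x))
    (\<lambda>x. 2 * (\<Sum>s\<in>UNIV. partial l (partial s f) x * partial s f x))"
proof -
  have "has_partial l (\<lambda>x. 1 + (\<Sum>s\<in>UNIV. partial s f x * partial s f x))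
    (\<lambda>x. 0 + (\<Sum>s\<in>UNIV. partial l (partial s f) x * partial s f x + partial s f x * partial l (partial s
        f) x))"
    by (intro has_partial_intros smooth_has_partial smooth_partial f)
  also have "(\<lambda>x. 0 + (\<Sum>s\<in>UNIV. partial l (partial s f) x * partial s f x + partial s f x *
      partial l (partial s f) x))
    = (\<lambda>x. 2 * (\<Sum>s\<in>UNIV. partial l (partial s f) x * partial s f x))"
    unfolding sum_distrib_left by (intro ext) (simp add: mult.commute)
  finally show ?thesis .
qed

lemma one_plus_sum_squares_nonzero: "1 + (\<Sum>s\<in>A. g s * g s) \<noteq> (0::real)"
  by (smt (verit) sum_nonneg zero_le_square)

lemma has_partial_curvature_field:
  assumes f: "smooth f"
  shows "has_partial l (curvature_field f j) (\<lambda>x.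
    (\<Sum>i\<in>UNIV. (partial l (partial i (partial i f)) x * partial j f x + partial i (partial i f) x *
        partial l (partial j f) x)
             - (partial l (partial i (partial j f)) x * partial i f x + partial i (partial j f) x *
                 partial l (partial i f) x))
      / (1 + (\<Sum>s\<in>UNIV. partial s f x * partial s f x))
    - (\<Sum>i\<in>UNIV. partial i (partial i f) x * partial j f x - partial i (partial j f) x * partial i f x)
      * (2 * (\<Sum>s\<in>UNIV. partial l (partial s f) x * partial s f x)) / (1 + (\<Sum>s\<in>UNIV. partial s f x *
          partial s f x))\<^sup>2)"
  unfolding curvature_field_def
  by (intro has_partial_divide has_partial_one_plus_norm_grad has_partial_diff has_partial_mult
      has_partial_sum
    smooth_has_partial smooth_partial f one_plus_sum_squares_nonzero)

text \<open>
  In the curvature tensor the third derivatives of \<open>f\<close> cancel, as the Gauss equation predicts. With \<open>h\<close>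
  the Hessian, \<open>a\<close> the gradient, \<open>u = h a\<close>, \<open>w = 1 + \<bar>a\<bar>\<^sup>2\<close>, \<open>H = tr h\<close>, \<open>S = \<bar>h\<bar>\<^sup>2\<close>, \<open>U = \<bar>u\<bar>\<^sup>2\<close> and \<open>N
  = a \<bullet> u\<close>, the contraction yields \<open>(H\<^sup>2 - S) / w - 2 (H N - U) / w\<^sup>2\<close>. In the divergence of the
  curvature field the two third-derivative terms cancel after summation, and the same expression
  remains.
\<close>

lemma scalar_curvature_graph_metric:
  fixes f :: "real^'n::finite \<Rightarrow> real"
  assumes f: "smooth f"
  shows "scalar_curvature (graph_metric f) x = (\<Sum>j\<in>UNIV. partial j (curvature_field f j) x)"
proof -
  define a where "a k = partial k f x" for k
  define h where "h i j = partial i (partial j f) x" for i j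
  define t where "t i j k = partial i (partial j (partial k f)) x" for i j k
  define w where "w = 1 + (\<Sum>s\<in>UNIV. a s * a s)"
  define u where "u l = (\<Sum>s\<in>UNIV. h l s * a s)" for l
  define q where "q j k = (\<Sum>i\<in>UNIV. h j i * h i k)" for j k
  define H where "H = (\<Sum>i\<in>UNIV. h i i)"
  define S where "S = (\<Sum>j\<in>UNIV. q j j)"
  define U where "U = (\<Sum>j\<in>UNIV. u j * u j)"
  define N where "N = (\<Sum>j\<in>UNIV. a j * u j)"
  have w: "w \<noteq> 0" unfolding w_def by (rule one_plus_sum_squares_nonzero)
  have h_sym: "h i j = h j i" for i j
    unfolding h_def using smooth_partial_commute[OF f] by metis
  have t_sym: "t i j k = t j i k" for i j k
    unfolding t_def using smooth_partial_commute[OF smooth_partial[OF f]] by metis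
  have \<Gamma>: "christoffel (graph_metric f) k i j x = h i j * a k / w" for k i j
    by (simp add: christoffel_graph_metric[OF f] a_def h_def w_def)
  have d\<Gamma>: "partial l (christoffel (graph_metric f) k i j) x = (t l i j * a k + h i j * h l k) / w -
      h i j * a k * (2 * u l) / w\<^sup>2" for l k i j
  proof -
    have "has_partial l (christoffel (graph_metric f) k i j) (\<lambda>x.
       (partial l (partial i (partial j f)) x * partial k f x + partial i (partial j f) x *
           partial l (partial k f) x)
         / (1 + (\<Sum>s\<in>UNIV. partial s f x * partial s f x)) -
       partial i (partial j f) x * partial k f x * (2 * (\<Sum>s\<in>UNIV. partial l (partial s f) x *
           partial s f x)) / (1 + (\<Sum>s\<in>UNIV. partial s f x * partial s f x))\<^sup>2)"
      unfolding christoffel_graph_metric[OF f]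
      by (intro has_partial_divide has_partial_one_plus_norm_grad has_partial_mult
         smooth_has_partial smooth_partial f one_plus_sum_squares_nonzero)
    from partial_eq[OF this] show ?thesis by (simp add: a_def h_def t_def w_def u_def)
  qed
  have u2: "(\<Sum>s\<in>UNIV. h s l * a s) = u l" for l
    unfolding u_def by (intro sum.cong refl) (metis h_sym)
  have riem: "riemann (graph_metric f) l k i j x =
      (h j k * h i l - h i k * h j l) / w - a l * (h j k * u i - h i k * u j) / w\<^sup>2" for l k i j
  proof -
    have "(\<Sum>s\<in>UNIV. h i s * a l / w * (h j k * a s / w) - h j s * a l / w * (h i k * a s / w)) =
      a l * h j k / w\<^sup>2 * u i - a l * h i k / w\<^sup>2 * u j"
      unfolding u_def sum_distrib_left sum_subtractf[symmetric]
      by (intro sum.cong refl) (simp add: power2_eq_square mult_ac)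
    then show ?thesis
      unfolding riemann_def \<Gamma> d\<Gamma> t_sym[of i j k]
      by (simp add: divide_inverse power2_eq_square algebra_simps)
  qed
  have ric: "ricci (graph_metric f) j k x = (H * h j k - q j k) / w - (h j k * N - u k * u j) / w\<^sup>2" for j k
  proof -
    have "ricci (graph_metric f) j k x = (\<Sum>i\<in>UNIV. (h i i * h j k - h j i * h i k) / w - (h j k * (a i *
        u i) - h i k * a i * u j) / w\<^sup>2)"
      unfolding ricci_def riem by (intro sum.cong refl) (simp add: algebra_simps)
    also have "\<dots> = ((\<Sum>i\<in>UNIV. h i i) * h j k - q j k) / w - (h j k * N - (\<Sum>i\<in>UNIV. h i k * a i) * u j) /
        w\<^sup>2"
      by (simp only: sum_subtractf sum_divide_distrib[symmetric] sum_distrib_left[symmetric]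
          sum_distrib_right[symmetric] q_def N_def)
    finally show ?thesis by (simp add: u2 H_def)
  qed
  have s1: "(\<Sum>j\<in>UNIV. \<Sum>k\<in>UNIV. a j * a k * h j k) = N"
    by (simp add: N_def u_def sum_distrib_left mult_ac)
  have s2: "(\<Sum>j\<in>UNIV. \<Sum>k\<in>UNIV. a j * a k * q j k) = U"
  proof -
    have "U = (\<Sum>i\<in>UNIV. (\<Sum>j\<in>UNIV. h j i * a j) * (\<Sum>k\<in>UNIV. h i k * a k))"
      unfolding u2 by (simp add: u_def U_def)
    also have "\<dots> = (\<Sum>i\<in>UNIV. \<Sum>j\<in>UNIV. \<Sum>k\<in>UNIV. h j i * a j * (h i k * a k))"
      by (simp add: sum_product)
    also have "\<dots> = (\<Sum>j\<in>UNIV. \<Sum>i\<in>UNIV. \<Sum>k\<in>UNIV. h j i * a j * (h i k * a k))"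
      by (rule sum.swap)
    also have "\<dots> = (\<Sum>j\<in>UNIV. \<Sum>k\<in>UNIV. \<Sum>i\<in>UNIV. h j i * a j * (h i k * a k))"
      by (intro sum.cong refl sum.swap)
    finally show ?thesis by (simp add: q_def sum_distrib_left mult_ac)
  qed
  have s3: "(\<Sum>j\<in>UNIV. \<Sum>k\<in>UNIV. a j * a k * (u k * u j)) = N * N"
    unfolding N_def sum_product by (intro sum.cong refl) (simp add: mult_ac)
  have "scalar_curvature (graph_metric f) x =
     (\<Sum>j\<in>UNIV. \<Sum>k\<in>UNIV. ((if j = k then 1 else 0) - a j * a k / w) * ricci (graph_metric f) j k x)"
    unfolding scalar_curvature_def graph_metric_eq matrix_inv_rank_one_update
    by (simp add: grad_def a_def w_def inner_vec_def)
  also have "\<dots> = (\<Sum>j\<in>UNIV. ricci (graph_metric f) j j x) - (\<Sum>j\<in>UNIV. \<Sum>k\<in>UNIV. a j * a k *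
      ricci (graph_metric f) j k x) / w"
  proof -
    have "((if j = k then 1 else 0) - a j * a k / w) * ricci (graph_metric f) j k x =
      (if j = k then ricci (graph_metric f) j k x else 0) - a j * a k * ricci (graph_metric f) j k x /
          w" for j k
      by (simp add: algebra_simps)
    then show ?thesis by (simp add: sum_subtractf sum_divide_distrib)
  qed
  also have "(\<Sum>j\<in>UNIV. ricci (graph_metric f) j j x) = (H * H - S) / w - (H * N - U) / w\<^sup>2"
    unfolding ric by (simp only: sum_subtractf sum_divide_distrib[symmetric] sum_distrib_left[symmetric]
        sum_distrib_right[symmetric] S_def U_def flip: H_def)
  also have "(\<Sum>j\<in>UNIV. \<Sum>k\<in>UNIV. a j * a k * ricci (graph_metric f) j k x) = (H * N - U) / w - (N * N - N
      * N) / w\<^sup>2"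
  proof -
    have "a j * a k * ricci (graph_metric f) j k x =
       (H * (a j * a k * h j k) - a j * a k * q j k) / w - (N * (a j * a k * h j k) - a j * a k * (u k *
           u j)) / w\<^sup>2" for j k
      unfolding ric by (simp add: algebra_simps diff_divide_distrib add_divide_distrib)
    then have "(\<Sum>j\<in>UNIV. \<Sum>k\<in>UNIV. a j * a k * ricci (graph_metric f) j k x) =
      (H * (\<Sum>j\<in>UNIV. \<Sum>k\<in>UNIV. a j * a k * h j k) - (\<Sum>j\<in>UNIV. \<Sum>k\<in>UNIV. a j * a k * q j k)) / w
       - (N * (\<Sum>j\<in>UNIV. \<Sum>k\<in>UNIV. a j * a k * h j k) - (\<Sum>j\<in>UNIV. \<Sum>k\<in>UNIV. a j * a k * (u k * u j))) / w\<^sup>2"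
      by (simp only: sum_subtractf sum_divide_distrib[symmetric] sum_distrib_left[symmetric])
    then show ?thesis unfolding s1 s2 s3 .
  qed
  finally have R: "scalar_curvature (graph_metric f) x = (H * H - S) / w - 2 * (H * N - U) / w\<^sup>2"
    by (simp add: divide_inverse power2_eq_square algebra_simps)
  have dV0: "partial j (curvature_field f j) x =
    (\<Sum>i\<in>UNIV. (t j i i * a j + h i i * h j j) - (t j i j * a i + h i j * h j i)) / w
    - (\<Sum>i\<in>UNIV. h i i * a j - h i j * a i) * (2 * u j) / w\<^sup>2" for j
    unfolding partial_eq[OF has_partial_curvature_field[OF f]]
    by (simp add: a_def h_def t_def w_def u_def)
  have e1: "(\<Sum>i\<in>UNIV. h i i * a j - h i j * a i) * (2 * u j) = 2 * (H * (a j * u j) - u j * u j)" for j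
    by (simp add: sum_subtractf sum_distrib_right[symmetric] u2 flip: H_def) (simp add: algebra_simps)
  have e2: "(\<Sum>i\<in>UNIV. (t j i i * a j + h i i * h j j) - (t j i j * a i + h i j * h j i))
      = (\<Sum>i\<in>UNIV. t j i i * a j) - (\<Sum>i\<in>UNIV. t j i j * a i) + (H * h j j - q j j)" for j
    unfolding H_def q_def sum_distrib_right
    by (simp add: sum_subtractf sum.distrib mult.commute)
  note dV = dV0[unfolded e1 e2]
  have tt: "(\<Sum>j\<in>UNIV. \<Sum>i\<in>UNIV. t j i i * a j) = (\<Sum>j\<in>UNIV. \<Sum>i\<in>UNIV. t j i j * a i)"
    by (subst sum.swap) (intro sum.cong refl, simp add: t_sym)
  have "(\<Sum>j\<in>UNIV. partial j (curvature_field f j) x) =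
     ((\<Sum>j\<in>UNIV. \<Sum>i\<in>UNIV. t j i i * a j) - (\<Sum>j\<in>UNIV. \<Sum>i\<in>UNIV. t j i j * a i) + (H * H - S)) / w - 2 *
         (H * N - U) / w\<^sup>2"
    unfolding dV
    by (simp only: sum_subtractf sum.distrib sum_divide_distrib[symmetric] sum_distrib_left[symmetric]
        S_def U_def N_def flip: H_def)
  then show ?thesis unfolding R tt by simp
qed

lemma continuous_curvature_field:
  assumes f: "smooth f"
  shows "continuous_on UNIV (curvature_field f j)"
  unfolding curvature_field_def
  by (intro continuous_intros smooth_continuous smooth_partial f ballI one_plus_sum_squares_nonzero)

lemma continuous_partial_curvature_field:
  assumes f: "smooth f"
  shows "continuous_on UNIV (partial l (curvature_field f j))"
  unfolding partial_eq[OF has_partial_curvature_field[OF f]]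
  by (intro continuous_intros smooth_continuous smooth_partial f ballI one_plus_sum_squares_nonzero)
      (simp add: one_plus_sum_squares_nonzero)

section \<open>Surface integrals over spheres\<close>

text \<open>
  The surface measure is a rescaled image of volume on the punctured unit ball under radial projection
  onto the sphere of radius \<open>r\<close>, so every surface integral is a volume integral of a function that is
  constant on rays. All facts about surface integrals below go back to this formula.
\<close>

lemma integral_sphere_area:
  fixes u :: "'a::euclidean_space \<Rightarrow> real"
  assumes [measurable]: "u \<in> borel_measurable borel" and r: "r \<ge> 0"
  shows "(LINT x|sphere_area r. u x) =
    real DIM('a) * r ^ (DIM('a) - 1) * (LINT x:cball 0 1 - {0}|lborel. u ((r / norm x) *\<^sub>R x))"
proof -
  let ?c = "real DIM('a) * r ^ (DIM('a) - 1)"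
  let ?R = "restrict_space lborel (cball 0 1 - {0::'a})"
  let ?M = "distr ?R borel (\<lambda>x::'a. (r / norm x) *\<^sub>R x)"
  have m [measurable]: "(\<lambda>x::'a. (r / norm x) *\<^sub>R x) \<in> ?R \<rightarrow>\<^sub>M borel"
    by (rule measurable_restrict_space1) simp
  have "sphere_area r = density ?M (\<lambda>_. ennreal ?c)"
    unfolding sphere_area_def by (rule measure_eqI) (auto simp: emeasure_density_const)
  then have "(LINT x|sphere_area r. u x) = (LINT x|?M. ?c * u x)"
    using r by (simp add: integral_density)
  also have "\<dots> = ?c * (LINT x|?R. u ((r / norm x) *\<^sub>R x))"
    by (simp add: integral_distr[OF m])
  also have "(LINT x|?R. u ((r / norm x) *\<^sub>R x)) = (LINT x:cball 0 1 - {0}|lborel. u ((r / norm x) *\<^sub>R x))"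
    unfolding set_lebesgue_integral_def by (rule integral_restrict_space) auto
  finally show ?thesis .
qed

lemma integral_sphere_area_cong:
  fixes u v :: "'a::euclidean_space \<Rightarrow> real"
  assumes "u \<in> borel_measurable borel" "v \<in> borel_measurable borel" "r \<ge> 0"
    and "\<And>x. norm x = r \<Longrightarrow> u x = v x"
  shows "(LINT x|sphere_area r. u x) = (LINT x|sphere_area r. v x)"
  using assms by (auto simp: integral_sphere_area intro!: set_lebesgue_integral_cong)

lemma borel_measurable_projected:
  fixes u :: "'a::euclidean_space \<Rightarrow> real"
  assumes "u \<in> borel_measurable borel" "A \<in> sets borel"
  shows "(\<lambda>x. indicat_real A x *\<^sub>R u ((r / norm x) *\<^sub>R x)) \<in> borel_measurable lborel"
proof -
  have "(\<lambda>x::'a. (r / norm x) *\<^sub>R x) \<in> borel \<rightarrow>\<^sub>M borel" by measurable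
  from measurable_compose[OF this assms(1)] assms(2) show ?thesis
    by (auto intro!: borel_measurable_scaleR borel_measurable_indicator)
qed

lemma norm_sphere_projection_le:
  assumes "r \<ge> 0" shows "norm ((r / norm x) *\<^sub>R (x::'a::real_normed_vector)) \<le> r"
  using assms by (cases "x = 0") auto

lemma continuous_bounded_on_cball:
  fixes u :: "'a::euclidean_space \<Rightarrow> real"
  assumes "continuous_on UNIV u"
  obtains M where "M \<ge> 0" "\<And>x. norm x \<le> r \<Longrightarrow> \<bar>u x\<bar> \<le> M"
proof -
  have "bounded (u ` cball 0 r)"
    by (intro compact_imp_bounded compact_continuous_image continuous_on_subset[OF assms]) auto
  then obtain M where "\<forall>x\<in>cball 0 r. \<bar>u x\<bar> \<le> M"
    by (auto simp: bounded_iff)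
  then have "\<And>x. norm x \<le> r \<Longrightarrow> \<bar>u x\<bar> \<le> max 0 M" by (simp add: le_max_iff_disj)
  with that[of "max 0 M"] show ?thesis by simp
qed

lemma set_integrable_bounded:
  fixes u :: "'a::euclidean_space \<Rightarrow> real"
  assumes [measurable]: "u \<in> borel_measurable borel" and [measurable]: "A \<in> sets borel"
    and "bounded A" and b: "\<And>x. x \<in> A \<Longrightarrow> \<bar>u x\<bar> \<le> M"
  shows "set_integrable lborel A u"
  unfolding set_integrable_def
proof (rule Bochner_Integration.integrable_bound)
  show "integrable lborel (\<lambda>x. indicator A x *\<^sub>R M)"
    using emeasure_bounded_finite[OF \<open>bounded A\<close>] by (simp add: less_top)
  show "AE x in lborel. norm (indicat_real A x *\<^sub>R u x) \<le> norm (indicat_real A x *\<^sub>R M)"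
    using b by (auto simp: indicator_def intro!: AE_I2) fastforce
qed simp

lemma set_integrable_cball:
  fixes u :: "'a::euclidean_space \<Rightarrow> real"
  assumes "continuous_on UNIV u"
  shows "set_integrable lborel (cball 0 y) u"
  using borel_integrable_compact[of "cball 0 y" u] assms unfolding set_integrable_def
  by (metis compact_cball continuous_on_subset subset_UNIV)

text \<open>
  Up to a power of the radius, surface integrals and ball integrals take this form: \<open>T = sgn\<close> gives the
  former and the identity the latter. Continuity in the radius follows by dominated convergence.
\<close>

lemma isCont_integral_scaled:
  fixes u :: "'a::euclidean_space \<Rightarrow> real" and T :: "'a \<Rightarrow> 'a"
  assumes u: "continuous_on UNIV u" and T: "T \<in> borel \<rightarrow>\<^sub>M borel"
    and A: "A \<in> sets borel" "A \<subseteq> cball 0 1" and T1: "\<And>x. x \<in> A \<Longrightarrow> norm (T x) \<le> 1"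
  shows "isCont (\<lambda>s. LINT x:A|lborel. u (s *\<^sub>R T x)) s"
  unfolding continuous_at_sequentially o_def
proof (intro allI impI)
  fix X :: "nat \<Rightarrow> real" assume X: "X \<longlonglongrightarrow> s"
  have um: "u \<in> borel_measurable borel"
    using u by (rule borel_measurable_continuous_onI)
  have "(\<lambda>x. s *\<^sub>R T x) \<in> borel \<rightarrow>\<^sub>M borel" for s using T by measurable
  from measurable_compose[OF this um]
  have m: "(\<lambda>x. indicat_real A x *\<^sub>R u (s *\<^sub>R T x)) \<in> borel_measurable lborel" for s
    using A by (auto intro!: borel_measurable_scaleR borel_measurable_indicator)
  obtain K where K: "\<And>n. \<bar>X n\<bar> \<le> K"
    using X by (metis convergentI convergent_imp_Bseq BseqE real_norm_def)
  obtain M where M: "M \<ge> 0" "\<And>x. norm x \<le> K \<Longrightarrow> \<bar>u x\<bar> \<le> M"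
    using continuous_bounded_on_cball[OF u] by blast
  show "(\<lambda>n. LINT x:A|lborel. u (X n *\<^sub>R T x)) \<longlonglongrightarrow> (LINT x:A|lborel. u (s *\<^sub>R T x))"
    unfolding set_lebesgue_integral_def
  proof (rule integral_dominated_convergence[where w="\<lambda>x. indicator (cball 0 1) x *\<^sub>R M"])
    show "integrable lborel (\<lambda>x::'a. indicator (cball 0 1) x *\<^sub>R M)"
      by (simp add: emeasure_cball)
    show "AE x in lborel. (\<lambda>n. indicat_real A x *\<^sub>R u (X n *\<^sub>R T x))
         \<longlonglongrightarrow> indicat_real A x *\<^sub>R u (s *\<^sub>R T x)"
      using X u by (intro AE_I2 tendsto_intros isCont_tendsto_compose[of _ u])
        (auto simp: continuous_on_eq_continuous_at)
    show "AE x in lborel. norm (indicat_real A x *\<^sub>R u (X n *\<^sub>R T x)) \<le>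
        indicat_real (cball 0 1) x *\<^sub>R M" for n
    proof (rule AE_I2)
      fix x :: 'a
      show "norm (indicat_real A x *\<^sub>R u (X n *\<^sub>R T x)) \<le> indicat_real (cball 0 1) x *\<^sub>R M"
      proof (cases "x \<in> A")
        case True
        then have "norm (T x) \<le> 1" "norm x \<le> 1" using A(2) T1 by auto
        then have "norm (X n *\<^sub>R T x) \<le> K * 1"
          unfolding norm_scaleR using K[of n] by (intro mult_mono) auto
        with True M(2)[of "X n *\<^sub>R T x"] \<open>norm x \<le> 1\<close> show ?thesis by simp
      qed (use M in auto)
    qed
  qed (rule m)+
qed

lemma lborel_integral_scale:
  fixes u :: "'a::euclidean_space \<Rightarrow> real"
  assumes [measurable]: "u \<in> borel_measurable borel" and c: "c > 0"
  shows "(LINT x|lborel. u x) = c ^ DIM('a) * (LINT x|lborel. u (c *\<^sub>R x))"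
  using c by (subst lborel_affine[of c 0]) (simp_all add: integral_density integral_distr)

text \<open>
  The integrand is constant on rays, so dilating the ball by \<open>y\<close> changes only the volume element.
\<close>

lemma integral_cball_projected:
  fixes u :: "'a::euclidean_space \<Rightarrow> real"
  assumes [measurable]: "u \<in> borel_measurable borel" and y: "y > 0"
  shows "(LINT x:cball 0 y|lborel. u ((r / norm x) *\<^sub>R x)) =
    y ^ DIM('a) * (LINT x:cball 0 1 - {0}|lborel. u ((r / norm x) *\<^sub>R x))"
proof -
  have "(LINT x:cball 0 y|lborel. u ((r / norm x) *\<^sub>R x)) =
    y ^ DIM('a) * (LINT x:cball 0 1|lborel. u ((r / norm x) *\<^sub>R x))"
    unfolding set_lebesgue_integral_def
    using y by (subst lborel_integral_scale[OF _ y])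
      (auto simp: indicator_def zero_le_mult_iff intro!: Bochner_Integration.integral_cong)
  also have "(LINT x:cball 0 1|lborel. u ((r / norm x) *\<^sub>R x)) = (LINT x:cball 0 1 - {0}|lborel. u ((r /
      norm x) *\<^sub>R x))"
    unfolding set_lebesgue_integral_def
  proof (rule integral_cong_AE)
    show "AE x in lborel. indicat_real (cball 0 1) x *\<^sub>R u ((r / norm x) *\<^sub>R x) =
        indicat_real (cball 0 1 - {0}) x *\<^sub>R u ((r / norm x) *\<^sub>R x)"
      using AE_lborel_singleton[of "0::'a"] by eventually_elim (simp add: indicator_def)
  qed (rule borel_measurable_projected; simp)+
  finally show ?thesis .
qed

lemma integral_annulus_le:
  fixes w :: "'a::euclidean_space \<Rightarrow> real"
  assumes [measurable]: "w \<in> borel_measurable borel" and ab: "0 \<le> a" "a \<le> b"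
    and int: "set_integrable lborel (cball 0 b) w"
    and le: "\<And>x. a < norm x \<Longrightarrow> norm x \<le> b \<Longrightarrow> \<bar>w x\<bar> \<le> e"
  shows "\<bar>(LINT x:cball 0 b|lborel. w x) - (LINT x:cball 0 a|lborel. w x)\<bar>
    \<le> e * (unit_ball_vol DIM('a) * (b ^ DIM('a) - a ^ DIM('a)))"
proof -
  have int': "set_integrable lborel (cball 0 a) w"
    by (rule set_integrable_subset[OF int]) (use ab in auto)
  have fin: "set_integrable lborel (cball 0 c) (\<lambda>x::'a. e)" for c
    unfolding set_integrable_def using emeasure_bounded_finite[OF bounded_cball[of "0::'a" c]]
        by (simp add: less_top)
  have vol: "(LINT x:cball (0::'a) c|lborel. e) = e * (unit_ball_vol DIM('a) * c ^ DIM('a))" if "c \<ge> 0"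
      for c
    using content_cball[OF that, of "0::'a"] by (simp add: set_lebesgue_integral_def measure_completion)
  have "\<bar>(LINT x:cball 0 b|lborel. w x) - (LINT x:cball 0 a|lborel. w x)\<bar> =
     \<bar>LINT x|lborel. indicator (cball 0 b) x *\<^sub>R w x - indicator (cball 0 a) x *\<^sub>R w x\<bar>"
    using int int' unfolding set_lebesgue_integral_def set_integrable_def by simp
  also have "\<dots> \<le> (LINT x|lborel. indicator (cball 0 b) x *\<^sub>R e - indicator (cball 0 a) (x::'a) *\<^sub>R e)"
    using int int' fin[of a] fin[of b] unfolding set_integrable_def
    by (intro integral_abs_bound[THEN order_trans] integral_mono)
       (use le ab in \<open>auto simp: indicator_def\<close>)
  also have "\<dots> = (LINT x:cball (0::'a) b|lborel. e) - (LINT x:cball (0::'a) a|lborel. e)"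
    using fin[of a] fin[of b] unfolding set_lebesgue_integral_def set_integrable_def by simp
  finally show ?thesis using ab by (simp add: vol algebra_simps)
qed

text \<open>
  Integration in polar coordinates, in differentiated form. Write \<open>u\<close> as its radial extension from the
  sphere of radius \<open>r\<close> plus a remainder \<open>w\<close> that vanishes on that sphere. The ball integral of the
  radial extension is exactly \<open>y ^ n\<close> times a constant, and its derivative at \<open>r\<close> is the surface
  integral. The remainder is uniformly small on thin shells around the sphere, by uniform continuity,
  and the volume of such a shell is of the order of its thickness; so the ball integral of \<open>w\<close> has
  derivative zero.
\<close>

lemma DERIV_integral_cball:
  fixes u :: "'a::euclidean_space \<Rightarrow> real"
  assumes u: "continuous_on UNIV u" and r: "r > 0"
  shows "((\<lambda>y. LINT x:cball 0 y|lborel. u x) has_real_derivative (LINT x|sphere_area r. u x)) (at r)"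
proof -
  let ?n = "DIM('a)"
  define w where "w x = u x - u ((r / norm x) *\<^sub>R x)" for x
  define G where "G = (LINT x:cball 0 1 - {0}|lborel. u ((r / norm x) *\<^sub>R x))"
  define D where "D y = (LINT x:cball 0 y|lborel. w x)" for y
  have um [measurable]: "u \<in> borel_measurable borel"
    using u by (rule borel_measurable_continuous_onI)
  have wm [measurable]: "w \<in> borel_measurable borel" unfolding w_def by measurable
  have int1: "set_integrable lborel (cball 0 y) u" for y
    by (rule set_integrable_cball[OF u])
  obtain M where M: "\<And>x. norm x \<le> r \<Longrightarrow> \<bar>u x\<bar> \<le> M"
    using continuous_bounded_on_cball[OF u] by blast
  have int2: "set_integrable lborel (cball 0 y) (\<lambda>x. u ((r / norm x) *\<^sub>R x))" for y
    by (rule set_integrable_bounded) (use M[OF norm_sphere_projection_le] r in auto)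
  have intw: "set_integrable lborel (cball 0 y) w" for y
    unfolding w_def using int1 int2 by (rule set_integral_diff)
  have D: "D y = (LINT x:cball 0 y|lborel. u x) - y ^ ?n * G" if "y > 0" for y
    unfolding D_def w_def G_def integral_cball_projected[OF um that, symmetric]
    using int1 int2 by (rule set_integral_diff)
  have "((\<lambda>y. (D y - D r) / (y - r)) \<longlongrightarrow> 0) (at r)"
  proof (rule LIM_I)
    fix e :: real assume e: "e > 0"
    \<comment> \<open>\<open>q\<close> compares the volume of the shell between the radii \<open>r\<close> and \<open>y\<close> with its thickness.\<close>
    define q where "q y = (y ^ ?n - r ^ ?n) / (y - r)" for y
    have "((\<lambda>y. y ^ ?n) has_real_derivative real ?n * r ^ (?n - 1)) (at r)"
      by (auto intro!: derivative_eq_intros)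
    then have "(q \<longlongrightarrow> real ?n * r ^ (?n - 1)) (at r)"
      unfolding has_field_derivative_iff q_def .
    from LIM_D[OF this, of 1] obtain d1 where d1: "d1 > 0"
      "\<And>y. y \<noteq> r \<Longrightarrow> \<bar>y - r\<bar> < d1 \<Longrightarrow> \<bar>q y - real ?n * r ^ (?n - 1)\<bar> < 1" by auto
    define K where "K = real ?n * r ^ (?n - 1) + 1"
    have K: "K > 0" unfolding K_def using r by (simp add: add_nonneg_pos)
    have qK: "\<bar>q y\<bar> \<le> K" if "y \<noteq> r" "\<bar>y - r\<bar> < d1" for y
    proof -
      have "0 \<le> real ?n * r ^ (?n - 1)" using r by simp
      with d1(2)[OF that] show ?thesis unfolding K_def abs_le_iff abs_less_iff by linarith
    qed
    define \<epsilon> where "\<epsilon> = e / (2 * K * unit_ball_vol ?n)"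
    have \<epsilon>: "\<epsilon> > 0" unfolding \<epsilon>_def using e K by simp
    have "uniformly_continuous_on (cball 0 (2 * r)) u"
      by (rule compact_uniformly_continuous[OF continuous_on_subset[OF u]]) auto
    then obtain d2 where d2: "d2 > 0" "\<And>x y. x \<in> cball 0 (2 * r) \<Longrightarrow> y \<in> cball 0 (2 * r) \<Longrightarrow> dist y x < d2 \<Longrightarrow>
        dist (u y) (u x) < \<epsilon>"
      unfolding uniformly_continuous_on_def using \<epsilon> by metis
    have wle: "\<bar>w x\<bar> \<le> \<epsilon>" if "\<bar>norm x - r\<bar> < d2" "\<bar>norm x - r\<bar> < r" for x
    proof -
      have x: "x \<noteq> 0" "norm x \<le> 2 * r" using that by auto
      have "x - (r / norm x) *\<^sub>R x = ((norm x - r) / norm x) *\<^sub>R x"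
        using x by (simp add: diff_divide_distrib scaleR_left_diff_distrib)
      then have "norm (x - (r / norm x) *\<^sub>R x) = \<bar>norm x - r\<bar>"
        using x by simp
      moreover have "norm ((r / norm x) *\<^sub>R x) \<le> 2 * r"
        using norm_sphere_projection_le[of r x] r by linarith
      ultimately show ?thesis
        using d2(2)[of "(r / norm x) *\<^sub>R x" x] that x by (simp add: w_def dist_norm)
    qed
    show "\<exists>s>0. \<forall>y. y \<noteq> r \<and> norm (y - r) < s \<longrightarrow> norm ((D y - D r) / (y - r) - 0) < e"
    proof (intro exI[of _ "min d1 (min d2 r)"] conjI allI impI)
      show "0 < min d1 (min d2 r)" using d1 d2 r by simp
      fix y assume y: "y \<noteq> r \<and> norm (y - r) < min d1 (min d2 r)"
      then have y': "y \<noteq> r" "\<bar>y - r\<bar> < d1" "\<bar>y - r\<bar> < d2" "\<bar>y - r\<bar> < r" "y > 0" by auto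
      have "\<bar>D y - D r\<bar> \<le> \<epsilon> * (unit_ball_vol ?n * \<bar>y ^ ?n - r ^ ?n\<bar>)"
      proof (cases "r \<le> y")
        case True
        have "\<bar>D y - D r\<bar> \<le> \<epsilon> * (unit_ball_vol ?n * (y ^ ?n - r ^ ?n))"
          unfolding D_def by (rule integral_annulus_le[OF wm _ _ intw]) (use True r y' wle in auto)
        moreover have "r ^ ?n \<le> y ^ ?n" using True r by (intro power_mono) auto
        ultimately show ?thesis by simp
      next
        case False
        have "\<bar>D r - D y\<bar> \<le> \<epsilon> * (unit_ball_vol ?n * (r ^ ?n - y ^ ?n))"
          unfolding D_def by (rule integral_annulus_le[OF wm _ _ intw], use False r y' in \<open>auto intro!:
              wle\<close>)
        moreover have "y ^ ?n \<le> r ^ ?n" using False y' by (intro power_mono) auto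
        ultimately show ?thesis by (simp add: abs_minus_commute)
      qed
      then have "\<bar>(D y - D r) / (y - r)\<bar> \<le> \<epsilon> * (unit_ball_vol ?n * \<bar>q y\<bar>)"
        using y' unfolding q_def abs_divide by (simp add: divide_right_mono field_simps)
      also have "\<dots> \<le> \<epsilon> * (unit_ball_vol ?n * K)"
        using \<epsilon> qK[OF y'(1,2)] by (intro mult_left_mono) auto
      also have "\<dots> = e / 2" unfolding \<epsilon>_def
          using K less_imp_neq[OF unit_ball_vol_pos[OF of_nat_0_le_iff], of ?n] by simp
      also have "\<dots> < e" using e by simp
      finally show "norm ((D y - D r) / (y - r) - 0) < e" by simp
    qed
  qed
  then have "(D has_real_derivative 0) (at r)"
    by (simp add: has_field_derivative_iff)
  then have "((\<lambda>y. D y + y ^ ?n * G) has_real_derivative (LINT x|sphere_area r. u x)) (at r)"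
    by (auto intro!: derivative_eq_intros simp: integral_sphere_area[OF um] less_imp_le[OF r] G_def)
  then show ?thesis
    by (rule has_field_derivative_transform_within_open[where S="{0<..}"]) (use r D in auto)
qed

text \<open>
  Linearity is inherited from ball integrals: both sides are derivatives of the same function of the
  radius.
\<close>

lemma integral_sphere_area_lincomb:
  fixes u v :: "'a::euclidean_space \<Rightarrow> real"
  assumes u: "continuous_on UNIV u" and v: "continuous_on UNIV v" and r: "r > 0"
  shows "(LINT x|sphere_area r. c * u x + d * v x) = c * (LINT x|sphere_area r. u x) + d *
      (LINT x|sphere_area r. v x)"
proof (rule DERIV_unique)
  have "(LINT x:cball 0 y|lborel. c * u x + d * v x) =
     c * (LINT x:cball 0 y|lborel. u x) + d * (LINT x:cball 0 y|lborel. v x)" for y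
    using set_integrable_cball[OF u] set_integrable_cball[OF v] by (simp add: set_integral_add)
  with DERIV_integral_cball[of "\<lambda>x. c * u x + d * v x" r] u v r
  show "((\<lambda>y. c * (LINT x:cball 0 y|lborel. u x) + d * (LINT x:cball 0 y|lborel. v x)) has_real_derivative
    (LINT x|sphere_area r. c * u x + d * v x)) (at r)"
    by (simp add: continuous_intros)
  show "((\<lambda>y. c * (LINT x:cball 0 y|lborel. u x) + d * (LINT x:cball 0 y|lborel. v x)) has_real_derivative
    c * (LINT x|sphere_area r. u x) + d * (LINT x|sphere_area r. v x)) (at r)"
    using u v r by (auto intro!: derivative_eq_intros DERIV_integral_cball)
qed

lemma continuous_on_integral_sphere_area:
  fixes u :: "'a::euclidean_space \<Rightarrow> real"
  assumes u: "continuous_on UNIV u"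
  shows "continuous_on {0..} (\<lambda>r. LINT x|sphere_area r. u x)"
proof -
  have s: "(r / norm x) *\<^sub>R x = r *\<^sub>R sgn x" for r and x :: 'a
    by (simp add: sgn_div_norm divide_inverse)
  have m: "sgn \<in> borel \<rightarrow>\<^sub>M (borel :: 'a measure)"
    unfolding sgn_div_norm[abs_def] by measurable
  have "continuous_on UNIV (\<lambda>r. LINT x:cball 0 1 - {0}|lborel. u (r *\<^sub>R sgn x))"
    unfolding continuous_on_eq_continuous_at[OF open_UNIV]
    by (intro ballI isCont_integral_scaled[OF u]) (auto simp: norm_sgn m)
  then have "continuous_on {0..} (\<lambda>r. real DIM('a) * r ^ (DIM('a) - 1) * (LINT x:cball 0 1 - {0}|lborel.
      u (r *\<^sub>R sgn x)))"
    by (intro continuous_intros) (auto intro: continuous_on_subset)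
  then show ?thesis
    by (rule continuous_on_eq) (simp add: integral_sphere_area borel_measurable_continuous_onI[OF u] s)
qed

lemma integral_cball_scale:
  fixes u :: "'a::euclidean_space \<Rightarrow> real"
  assumes u: "u \<in> borel_measurable borel" and r: "r \<ge> 0"
  shows "(LINT x:cball 0 r|lborel. u x) = r ^ DIM('a) * (LINT x:cball 0 1|lborel. u (r *\<^sub>R x))"
proof (cases "r = 0")
  case True
  have "(LINT x:cball 0 r|lborel. u x) = (LINT x|(lborel::'a measure). 0)"
    unfolding set_lebesgue_integral_def
  proof (rule integral_cong_AE)
    show "AE x in lborel. indicat_real (cball 0 r) x *\<^sub>R u x = 0"
      using AE_lborel_singleton[of "0::'a"] by eventually_elim (simp add: indicator_def True)
  qed (simp_all add: u borel_measurable_times borel_measurable_indicator)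
  then show ?thesis using True by simp
next
  case False
  then show ?thesis
    unfolding set_lebesgue_integral_def
    using u r by (subst lborel_integral_scale[of _ r])
      (auto simp: indicator_def intro!: Bochner_Integration.integral_cong)
qed

lemma continuous_on_integral_cball:
  fixes u :: "'a::euclidean_space \<Rightarrow> real"
  assumes u: "continuous_on UNIV u"
  shows "continuous_on {0..} (\<lambda>r. LINT x:cball 0 r|lborel. u x)"
proof -
  have "continuous_on UNIV (\<lambda>r. LINT x:cball 0 1|lborel. u (r *\<^sub>R x))"
    unfolding continuous_on_eq_continuous_at[OF open_UNIV]
    by (intro ballI isCont_integral_scaled[OF u]) auto
  then have "continuous_on {0..} (\<lambda>r. r ^ DIM('a) * (LINT x:cball 0 1|lborel. u (r *\<^sub>R x)))"
    by (intro continuous_intros) (auto intro: continuous_on_subset)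
  then show ?thesis
    by (rule continuous_on_eq) (simp add: integral_cball_scale[OF borel_measurable_continuous_onI[OF u]])
qed

lemma integral_sphere_area_le:
  fixes u :: "'a::euclidean_space \<Rightarrow> real"
  assumes [measurable]: "u \<in> borel_measurable borel" and r: "r \<ge> 0"
    and le: "\<And>x. norm x = r \<Longrightarrow> \<bar>u x\<bar> \<le> M"
  shows "\<bar>LINT x|sphere_area r. u x\<bar> \<le> real DIM('a) * unit_ball_vol DIM('a) * r ^ (DIM('a) - 1) * M"
proof -
  let ?A = "cball 0 1 - {0::'a}"
  have int: "set_integrable lborel ?A (\<lambda>x::'a. M)"
    by (rule set_integrable_bounded[where M="\<bar>M\<bar>"]) (auto intro: bounded_subset[OF bounded_cball])
  have int2: "set_integrable lborel ?A (\<lambda>x. u ((r / norm x) *\<^sub>R x))"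
    by (rule set_integrable_bounded[where M=M]) (use le r in \<open>auto intro: bounded_subset[OF bounded_cball]\<close>)
  have "\<bar>LINT x:?A|lborel. u ((r / norm x) *\<^sub>R x)\<bar> \<le> (LINT x:?A|lborel. M)"
    using int int2 unfolding set_lebesgue_integral_def set_integrable_def
    by (intro integral_abs_bound[THEN order_trans] integral_mono) (use le r in \<open>auto simp: indicator_def\<close>)
  also have "\<dots> = (LINT x:cball (0::'a) 1|lborel. M)"
    unfolding set_lebesgue_integral_def
  proof (rule integral_cong_AE)
    show "AE x in lborel. indicat_real ?A x *\<^sub>R M = indicat_real (cball 0 1) x *\<^sub>R M"
      using AE_lborel_singleton[of "0::'a"] by eventually_elim (simp add: indicator_def)
  qed (intro borel_measurable_scaleR borel_measurable_indicator; simp)+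
  also have "\<dots> = unit_ball_vol DIM('a) * M"
    using content_cball[of 1 "0::'a"] by (simp add: set_lebesgue_integral_def)
  finally have "\<bar>LINT x:?A|lborel. u ((r / norm x) *\<^sub>R x)\<bar> \<le> unit_ball_vol DIM('a) * M" .
  then show ?thesis
    using mult_left_mono[of _ _ "real DIM('a) * r ^ (DIM('a) - 1)"] r
    by (simp add: integral_sphere_area abs_mult mult.assoc mult.left_commute[of "unit_ball_vol _"])
qed

section \<open>The divergence theorem on balls\<close>

text \<open>
  Translating \<open>\<phi>\<close> along \<open>e\<close> does not change its integral; differentiating that constant under the
  integral sign gives the integral of the directional derivative.
\<close>

lemma integral_directional_derivative_eq_0:
  fixes \<phi> \<phi>' :: "'a::euclidean_space \<Rightarrow> real" and e :: 'a
  assumes c: "continuous_on UNIV \<phi>" and c': "continuous_on UNIV \<phi>'"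
    and d: "\<And>x. ((\<lambda>t. \<phi> (x + t *\<^sub>R e)) has_real_derivative \<phi>' x) (at 0)"
    and z: "\<And>x. norm x \<ge> R \<Longrightarrow> \<phi> x = 0" and z': "\<And>x. norm x \<ge> R \<Longrightarrow> \<phi>' x = 0"
  shows "(LINT x|lborel. \<phi>' x) = 0"
proof -
  obtain a where a: "cball 0 (R + norm e) \<subseteq> cbox (-a) (a::'a)"
    using bounded_subset_cbox_symmetric[OF bounded_cball] by blast
  have box: "integral (cbox (-a) a) \<psi> = (LINT x|lborel. \<psi> x)"
    if "continuous_on UNIV \<psi>" "\<And>x. norm x \<ge> R + norm e \<Longrightarrow> \<psi> x = 0" for \<psi> :: "'a \<Rightarrow> real"
  proof -
    have "set_integrable lborel (cbox (-a) a) \<psi>"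
      using borel_integrable_compact[of "cbox (-a) a" \<psi>] that(1) unfolding set_integrable_def
      by (metis compact_cbox continuous_on_subset subset_UNIV)
    from set_borel_integral_eq_integral(2)[OF this]
    have "integral (cbox (-a) a) \<psi> = (LINT x:cbox (-a) a|lborel. \<psi> x)" ..
    also have "\<dots> = (LINT x|lborel. \<psi> x)"
      unfolding set_lebesgue_integral_def
    proof (rule Bochner_Integration.integral_cong[OF refl])
      fix x
      show "indicat_real (cbox (-a) a) x *\<^sub>R \<psi> x = \<psi> x"
        using that(2)[of x] subsetD[OF a, of x] by (cases "norm x \<ge> R + norm e") (auto simp: indicator_def)
    qed
    finally show ?thesis .
  qed
  have const: "integral (cbox (-a) a) (\<lambda>x. \<phi> (x + t *\<^sub>R e)) = (LINT x|lborel. \<phi> x)"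
      if t: "t \<in> {-1<..<1}" for t
  proof -
    have "\<phi> (x + t *\<^sub>R e) = 0" if "norm x \<ge> R + norm e" for x
    proof (rule z)
      have "norm x \<le> norm (x + t *\<^sub>R e) + norm (t *\<^sub>R e)" by (metis add_diff_cancel norm_triangle_ineq4)
      moreover have "norm (t *\<^sub>R e) \<le> 1 * norm e" unfolding norm_scaleR using t
          by (intro mult_right_mono) auto
      ultimately show "R \<le> norm (x + t *\<^sub>R e)" using that by simp
    qed
    then have "integral (cbox (-a) a) (\<lambda>x. \<phi> (x + t *\<^sub>R e)) = (LINT x|lborel. \<phi> (t *\<^sub>R e + x))"
      by (subst box) (auto intro!: continuous_intros continuous_on_compose2[OF c] simp: add.commute)
    also have "\<dots> = (LINT x|distr lborel borel ((+) (t *\<^sub>R e)). \<phi> x)"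
      using borel_measurable_continuous_onI[OF c] by (simp add: integral_distr)
    finally show ?thesis by (simp add: lborel_distr_plus)
  qed
  have "((\<lambda>t. integral (cbox (-a) a) (\<lambda>x. \<phi> (x + t *\<^sub>R e))) has_field_derivative
      integral (cbox (-a) a) (\<lambda>x. \<phi>' (x + 0 *\<^sub>R e))) (at 0 within {-1<..<1})"
  proof (rule leibniz_rule_field_derivative)
    show "((\<lambda>t. \<phi> (x + t *\<^sub>R e)) has_field_derivative \<phi>' (x + t *\<^sub>R e)) (at t within {-1<..<1})" for t x
      using DERIV_line_shift[OF d] by (rule DERIV_subset) auto
    show "(\<lambda>x. \<phi> (x + t *\<^sub>R e)) integrable_on cbox (-a) a" for t
      by (intro integrable_continuous continuous_on_compose2[OF c] continuous_intros) auto
    show "continuous_on ({-1<..<1} \<times> cbox (-a) a) (\<lambda>(t, x). \<phi>' (x + t *\<^sub>R e))"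
      unfolding split_beta by (intro continuous_on_compose2[OF c'] continuous_intros) auto
  qed auto
  then have "((\<lambda>t. integral (cbox (-a) a) (\<lambda>x. \<phi> (x + t *\<^sub>R e))) has_real_derivative
      integral (cbox (-a) a) \<phi>') (at 0)"
    by (simp add: at_within_open[of 0 "{-1<..<1}"])
  then have "((\<lambda>t. LINT x|lborel. \<phi> x) has_real_derivative integral (cbox (-a) a) \<phi>') (at 0)"
    by (rule has_field_derivative_transform_within_open[where S="{-1<..<1}"]) (simp_all add: const)
  then have "integral (cbox (-a) a) \<phi>' = 0"
    using DERIV_const DERIV_unique by blast
  moreover have "\<phi>' x = 0" if "norm x \<ge> R + norm e" for x
    using that norm_ge_zero[of e] by (intro z') linarith
  ultimately show ?thesis using box[OF c'] by simp
qed

text \<open>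
  With \<open>A s\<close> the integral of \<open>div V\<close> over the ball of radius \<open>s\<close> and \<open>F s\<close> the surface integral of \<open>V \<bullet>
  x\<close>, the claim is that \<open>E s = F s - s * A s\<close> vanishes. For every \<open>\<eta>\<close> of class \<open>C\<^sup>1\<close> with \<open>\<eta> = 0\<close> beyond
  \<open>R\<^sup>2\<close>, the divergence of the compactly supported field \<open>\<eta> (x \<bullet> x) V x\<close> integrates to zero. Expanding
  this divergence, passing to radial integrals and integrating by parts turns the identity into the
  vanishing of the integral of \<open>2 * \<eta>' (s\<^sup>2) * E s\<close> over \<open>0 < s < R\<close>. The choice \<open>\<eta>' (s\<^sup>2) = E s * (R\<^sup>2
  - s\<^sup>2)\<close> makes the integrand nonnegative, and so forces \<open>E = 0\<close>.
\<close>

theorem divergence_theorem_ball: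
  fixes V dV :: "'n::finite \<Rightarrow> real^'n \<Rightarrow> real"
  assumes V: "\<And>i. continuous_on UNIV (V i)" and dV: "\<And>i. continuous_on UNIV (dV i)"
    and deriv: "\<And>i. has_partial i (V i) (dV i)"
    and r: "r > 0"
  shows "(LINT x:cball 0 r|lborel. (\<Sum>i\<in>UNIV. dV i x)) = (LINT x|sphere_area r. (\<Sum>i\<in>UNIV. V i x * (x $ i
      / norm x)))"
proof -
  define a where "a x = (\<Sum>i\<in>UNIV. dV i x)" for x
  define u where "u x = (\<Sum>i\<in>UNIV. V i x * x $ i)" for x
  have a: "continuous_on UNIV a" unfolding a_def by (intro continuous_intros dV)
  have u: "continuous_on UNIV u" unfolding u_def by (intro continuous_intros V)
  define A where "A s = (LINT x:cball 0 s|lborel. a x)" for s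
  define F where "F s = (LINT x|sphere_area s. u x)" for s
  define E where "E s = F s - s * A s" for s
  define R where "R = r + 1"
  have R: "R > 0" "r < R" using r by (auto simp: R_def)
  have contA: "continuous_on {0..} A" unfolding A_def by (rule continuous_on_integral_cball[OF a])
  have contE: "continuous_on {0..} E"
    unfolding E_def F_def by (intro continuous_intros contA continuous_on_integral_sphere_area[OF u])
  define \<kappa> where "\<kappa> t = E (sqrt (max 0 t)) * max 0 (R\<^sup>2 - t)" for t
  have cont\<kappa>: "continuous_on UNIV \<kappa>"
    unfolding \<kappa>_def by (intro continuous_intros continuous_on_compose2[OF contE]) auto
  obtain \<eta>0 where \<eta>0: "\<And>t. (\<eta>0 has_vector_derivative \<kappa> t) (at t)"
    using einterval_antiderivative[of "-\<infinity>" "\<infinity>" \<kappa>] cont\<kappa>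
    by (auto simp: continuous_on_eq_continuous_at)
  define \<eta> where "\<eta> t = \<eta>0 t - \<eta>0 (R\<^sup>2)" for t
  have \<eta>: "(\<eta> has_real_derivative \<kappa> t) (at t)" for t
    using \<eta>0 unfolding \<eta>_def
    by (auto intro!: derivative_eq_intros simp: has_real_derivative_iff_has_vector_derivative)
  have \<kappa>0: "\<kappa> t = 0" if "t \<ge> R\<^sup>2" for t
    using that by (simp add: \<kappa>_def)
  have \<eta>0: "\<eta> t = 0" if "t \<ge> R\<^sup>2" for t
  proof (cases "t = R\<^sup>2")
    case False
    have "\<eta> t = \<eta> (R\<^sup>2)"
    proof (rule DERIV_isconst_end[of "R\<^sup>2" t \<eta>])
      show "continuous_on {R\<^sup>2..t} \<eta>" using \<eta> by (meson DERIV_continuous_on DERIV_subset top_greatest)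
      show "(\<eta> has_real_derivative 0) (at x)" if "R\<^sup>2 < x" "x < t" for x
        using \<eta>[of x] \<kappa>0[of x] that by simp
    qed (use that False in auto)
    then show ?thesis by (simp add: \<eta>_def)
  qed (simp add: \<eta>_def)
  have cont\<eta>: "continuous_on UNIV \<eta>"
    using \<eta> by (auto simp: continuous_on_eq_continuous_at intro: DERIV_isCont)
  define w where "w x = 2 * \<kappa> (x \<bullet> x) * u x + \<eta> (x \<bullet> x) * a x" for x
  have contw: "continuous_on UNIV w"
    unfolding w_def by (intro continuous_intros u a continuous_on_compose2[OF cont\<kappa>]
        continuous_on_compose2[OF cont\<eta>]) auto
  have sq: "R\<^sup>2 \<le> x \<bullet> x" if "R \<le> norm x" for x :: "real^'n"
    using that R by (simp add: dot_square_norm power_mono)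
  define w' where "w' i x = 2 * \<kappa> (x \<bullet> x) * (V i x * x $ i) + \<eta> (x \<bullet> x) * dV i x" for i x
  have contw': "continuous_on UNIV (w' i)" for i
    unfolding w'_def by (intro continuous_intros V dV continuous_on_compose2[OF cont\<kappa>]
        continuous_on_compose2[OF cont\<eta>]) auto
  have int0: "(LINT x|lborel. w' i x) = 0" for i
  proof (rule integral_directional_derivative_eq_0[where e="axis i 1" and \<phi>="\<lambda>x. \<eta> (x \<bullet> x) * V i x"])
    show "continuous_on UNIV (\<lambda>x. \<eta> (x \<bullet> x) * V i x)"
      by (intro continuous_intros V continuous_on_compose2[OF cont\<eta>]) auto
    fix x :: "real^'n"
    have "((\<lambda>t. (x + t *\<^sub>R axis i 1) \<bullet> (x + t *\<^sub>R axis i 1)) has_real_derivative 2 * x $ i) (at 0)"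
      unfolding inner_add_left inner_add_right inner_scaleR_left inner_scaleR_right
      by (auto intro!: derivative_eq_intros simp: inner_axis inner_axis')
    then have "((\<lambda>t. \<eta> ((x + t *\<^sub>R axis i 1) \<bullet> (x + t *\<^sub>R axis i 1))) has_real_derivative \<kappa> (x \<bullet> x) *
        (2 * x $ i)) (at 0)"
      using \<eta>[of "x \<bullet> x"] by (intro DERIV_chain2[where f=\<eta>]) auto
    from DERIV_mult[OF this deriv[of i, unfolded has_partial_def, rule_format, of x]]
    show "((\<lambda>t. \<eta> ((x + t *\<^sub>R axis i 1) \<bullet> (x + t *\<^sub>R axis i 1)) * V i (x +
        t *\<^sub>R axis i 1)) has_real_derivative w' i x) (at 0)"
      by (simp add: w'_def algebra_simps)
  qed (use \<eta>0 \<kappa>0 sq contw' in \<open>auto simp: w'_def\<close>)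
  have w_sum: "w x = (\<Sum>i\<in>UNIV. w' i x)" for x
    by (simp add: w_def w'_def u_def a_def sum.distrib sum_distrib_left)
  have w'_out: "w' i x = 0" if "x \<notin> cball 0 R" for i x
    using that \<eta>0 \<kappa>0 sq[of x] by (auto simp: w'_def)
  have w'_int: "integrable lborel (w' i)" for i
    using set_integrable_cball[OF contw', of R i] unfolding set_integrable_def
    by (rule Bochner_Integration.integrable_cong[THEN iffD1, rotated -1]) (use w'_out in \<open>auto simp:
        indicator_def\<close>)
  define Q where "Q s = (LINT x:cball 0 s|lborel. w x)" for s
  have "Q R = (LINT x|lborel. w x)"
    unfolding Q_def set_lebesgue_integral_def
    by (intro Bochner_Integration.integral_cong) (use w'_out in \<open>auto simp: indicator_def w_sum\<close>)
  also have "\<dots> = 0"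
    unfolding w_sum using w'_int int0 by simp
  finally have QR: "Q R = 0" .
  have contQ: "continuous_on {0..} Q" unfolding Q_def by (rule continuous_on_integral_cball[OF contw])
  have A0: "A 0 = 0" and Q0: "Q 0 = 0"
    unfolding A_def Q_def using integral_cball_scale[of a 0] integral_cball_scale[of w 0] a contw
    by (simp_all add: borel_measurable_continuous_onI)
  \<comment> \<open>\<open>P\<close> is a primitive of the nonnegative integrand that vanishes at both ends of \<open>[0, R]\<close>.\<close>
  define P where "P s = Q s - \<eta> (s\<^sup>2) * A s" for s
  have P': "(P has_real_derivative 2 * (E s)\<^sup>2 * (R\<^sup>2 - s\<^sup>2)) (at s)" if s: "0 < s" "s < R" for s
  proof -
    have s2: "s\<^sup>2 \<le> R\<^sup>2" using s by (intro power_mono) auto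
    have "(Q has_real_derivative (LINT x|sphere_area s. w x)) (at s)"
      unfolding Q_def by (rule DERIV_integral_cball[OF contw s(1)])
    also have "(LINT x|sphere_area s. w x) = (LINT x|sphere_area s. (2 * \<kappa> (s\<^sup>2)) * u x + \<eta> (s\<^sup>2) * a x)"
      by (rule integral_sphere_area_cong)
         (use s u a contw in \<open>auto intro!: borel_measurable_continuous_onI continuous_intros simp: w_def
             dot_square_norm\<close>)
    also have "\<dots> = 2 * \<kappa> (s\<^sup>2) * F s + \<eta> (s\<^sup>2) * (LINT x|sphere_area s. a x)"
      unfolding F_def by (rule integral_sphere_area_lincomb[OF u a s(1)])
    finally have Q': "(Q has_real_derivative 2 * \<kappa> (s\<^sup>2) * F s + \<eta> (s\<^sup>2) * (LINT x|sphere_area s.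
        a x)) (at s)" .
    have A': "(A has_real_derivative (LINT x|sphere_area s. a x)) (at s)"
      unfolding A_def by (rule DERIV_integral_cball[OF a s(1)])
    have "((\<lambda>s. \<eta> (s\<^sup>2)) has_real_derivative \<kappa> (s\<^sup>2) * (2 * s)) (at s)"
      by (rule DERIV_chain2[OF \<eta>]) (auto intro!: derivative_eq_intros)
    from DERIV_diff[OF Q' DERIV_mult[OF this A']]
    have "(P has_real_derivative 2 * \<kappa> (s\<^sup>2) * E s) (at s)"
      unfolding P_def by (rule DERIV_cong) (simp add: E_def algebra_simps)
    moreover have "2 * \<kappa> (s\<^sup>2) * E s = 2 * (E s)\<^sup>2 * (R\<^sup>2 - s\<^sup>2)"
      using s s2 by (simp add: \<kappa>_def power2_eq_square)
    ultimately show ?thesis by (rule DERIV_cong)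
  qed
  have contP: "continuous_on {0..R} P"
    unfolding P_def
    by (intro continuous_intros continuous_on_subset[OF contQ] continuous_on_subset[OF contA]
        continuous_on_compose2[OF cont\<eta>]) auto
  have P0: "P 0 = 0" "P R = 0" using QR A0 Q0 \<eta>0 by (auto simp: P_def)
  have mono: "P s \<le> P t" if "0 \<le> s" "s \<le> t" "t \<le> R" for s t
  proof (rule DERIV_nonneg_imp_increasing_open[OF that(2)])
    fix x assume x: "s < x" "x < t"
    then have "x\<^sup>2 \<le> R\<^sup>2" using that by (intro power_mono) auto
    then show "\<exists>y. (P has_real_derivative y) (at x) \<and> 0 \<le> y"
      using P'[of x] x that by (intro exI[of _ "2 * (E x)\<^sup>2 * (R\<^sup>2 - x\<^sup>2)"] conjI mult_nonneg_nonneg) auto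
  qed (use that in \<open>auto intro: continuous_on_subset[OF contP]\<close>)
  have P_zero: "P s = 0" if "s \<in> {0<..<R}" for s
    using mono[of 0 s] mono[of s R] P0 that by auto
  have "(P has_real_derivative 0) (at r)"
    by (rule has_field_derivative_transform_within_open[of "\<lambda>_. 0" _ _ "{0<..<R}"]) (use P_zero R r in auto)
  with P'[OF r R(2)] have "2 * (E r)\<^sup>2 * (R\<^sup>2 - r\<^sup>2) = 0" by (rule DERIV_unique)
  moreover have "r\<^sup>2 < R\<^sup>2" using r R by (intro power_strict_mono) auto
  ultimately have "E r = 0" by simp
  then have "r * A r = (LINT x|sphere_area r. u x)" by (simp add: E_def F_def)
  have um: "u \<in> borel_measurable borel" by (rule borel_measurable_continuous_onI[OF u])
  have [measurable]: "V i \<in> borel_measurable borel" for i by (rule borel_measurable_continuous_onI[OF V])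
  have "(LINT x|sphere_area r. (\<Sum>i\<in>UNIV. V i x * (x $ i / norm x))) = (LINT x|sphere_area r. u x / r)"
    by (rule integral_sphere_area_cong) (use r um in \<open>auto simp: u_def sum_divide_distrib\<close>)
  also have "\<dots> = (LINT x|sphere_area r. u x) / r" by simp
  also have "\<dots> = A r"
    using \<open>r * A r = _\<close>[symmetric] r by simp
  finally show ?thesis by (simp add: A_def a_def)
qed

section \<open>Decay at infinity\<close>

lemma eventually_at_infinity_norm:
  fixes P :: "'a::real_normed_vector \<Rightarrow> bool"
  assumes "eventually P at_infinity"
  obtains b where "b > 0" "\<And>x. norm x \<ge> b \<Longrightarrow> P x"
proof -
  obtain b where "\<And>x. norm x \<ge> b \<Longrightarrow> P x" using assms by (auto simp: eventually_at_infinity)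
  with that[of "max b 1"] show ?thesis by auto
qed

lemma bigo_powr_norm_at_infinity:
  fixes u :: "'a::real_normed_vector \<Rightarrow> real"
  assumes "u \<in> O[at_infinity](\<lambda>x. norm x powr s)"
  obtains C b where "C > 0" "b > 0" "\<And>x. norm x \<ge> b \<Longrightarrow> \<bar>u x\<bar> \<le> C * norm x powr s"
proof -
  from assms obtain C where C: "C > 0" "eventually (\<lambda>x. norm (u x) \<le> C * norm (norm x powr s)) at_infinity"
    by (rule landau_o.bigE)
  from eventually_at_infinity_norm[OF C(2)] obtain b where "b > 0" "\<And>x. norm x \<ge> b \<Longrightarrow> norm (u x) \<le>
      C * norm (norm x powr s)"
    by blast
  with that[OF C(1)] show ?thesis by simp
qed

text \<open>
  By the polar form of the ball integral, the integral of \<open>\<bar>u\<bar>\<close> over a ball of radius \<open>s\<close> grows at rate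
  at most \<open>K * s powr (n - 1 - q)\<close>, which is integrable at infinity because \<open>q > n\<close>. So \<open>G\<close>, the ball
  integral plus the tail integral of this rate, is nonincreasing, which bounds all ball integrals;
  monotone convergence concludes.
\<close>

lemma integrable_bigo_powr_norm:
  fixes u :: "'a::euclidean_space \<Rightarrow> real"
  assumes u: "continuous_on UNIV u" and q: "q > real DIM('a)"
    and decay: "u \<in> O[at_infinity](\<lambda>x. norm x powr (-q))"
  shows "integrable lborel u"
proof -
  let ?n = "DIM('a)"
  obtain C b where C: "C > 0" and b: "b > 0" and le: "\<And>x. norm x \<ge> b \<Longrightarrow> \<bar>u x\<bar> \<le> C * norm x powr (-q)"
    using bigo_powr_norm_at_infinity[OF decay] by blast
  have um [measurable]: "u \<in> borel_measurable borel" using u by (rule borel_measurable_continuous_onI)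
  define v where "v x = \<bar>u x\<bar>" for x
  have v: "continuous_on UNIV v" unfolding v_def by (intro continuous_intros u)
  have vm [measurable]: "v \<in> borel_measurable borel" using v by (rule borel_measurable_continuous_onI)
  define P where "P r = (LINT x:cball 0 r|lborel. v x)" for r
  define K where "K = real ?n * unit_ball_vol ?n * C"
  have K: "K \<ge> 0" unfolding K_def using C by simp
  define G where "G s = P s + K / (q - real ?n) * s powr (real ?n - q)" for s
  have "G s \<le> G b" if s: "b \<le> s" for s
  proof (rule DERIV_nonpos_imp_nonincreasing[OF s])
    fix x assume x: "b \<le> x" "x \<le> s"
    then have x0: "x > 0" using b by simp
    have "(P has_real_derivative (LINT y|sphere_area x. v y)) (at x)"
      unfolding P_def by (rule DERIV_integral_cball[OF v x0])
    moreover have "((\<lambda>s. K / (q - real ?n) * s powr (real ?n - q)) has_real_derivative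
       K / (q - real ?n) * ((real ?n - q) * x powr (real ?n - q - 1))) (at x)"
      using x0 q by (auto intro!: derivative_eq_intros)
    ultimately have "(G has_real_derivative (LINT y|sphere_area x. v y) + K / (q - real ?n) * ((real ?n
        - q) * x powr (real ?n - q - 1))) (at x)"
      unfolding G_def by (rule DERIV_add)
    also have "K / (q - real ?n) * ((real ?n - q) * x powr (real ?n - q - 1)) = - (K * x powr (real ?n -
        q - 1))"
      using q by (simp add: field_simps)
    finally have "(G has_real_derivative (LINT y|sphere_area x. v y) + - (K * x powr (real ?n - q -
        1))) (at x)" .
    moreover have "(LINT y|sphere_area x. v y) \<le> K * x powr (real ?n - q - 1)"
    proof -
      have "\<bar>LINT y|sphere_area x. v y\<bar> \<le> real ?n * unit_ball_vol ?n * x ^ (?n - 1) * (C * x powr (-q))"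
        by (rule integral_sphere_area_le) (use le x x0 in \<open>auto simp: v_def\<close>)
      also have "x ^ (?n - 1) = x powr (real ?n - 1)"
        using x0 by (simp add: powr_realpow[symmetric] of_nat_diff Suc_leI)
      also have "real ?n * unit_ball_vol ?n * x powr (real ?n - 1) * (C * x powr (-q)) =
          K * (x powr (real ?n - 1) * x powr (-q))"
        by (simp add: K_def)
      also have "x powr (real ?n - 1) * x powr (-q) = x powr (real ?n - q - 1)"
        by (simp add: powr_add[symmetric] algebra_simps)
      finally show ?thesis by simp
    qed
    ultimately show "\<exists>y. (G has_real_derivative y) (at x) \<and> y \<le> 0"
      by (intro exI conjI) auto
  qed
  moreover have "P s \<le> G s" for s
    unfolding G_def using K q by simp
  ultimately have Pb: "P s \<le> G b" if "b \<le> s" for s using that by (meson order_trans)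
  have P_mono: "P r \<le> P s" if "r \<le> s" for r s
    unfolding P_def set_lebesgue_integral_def
    using that set_integrable_cball[OF v]
    by (intro integral_mono) (auto simp: set_integrable_def indicator_def v_def)
  have "incseq (\<lambda>k::nat. P (real k))" by (intro monoI P_mono) simp
  moreover have "P (real k) \<le> G b" for k
    using Pb[of "max b (real k)"] P_mono[of "real k" "max b (real k)"] by simp
  ultimately obtain L where L: "(\<lambda>k::nat. P (real k)) \<longlonglongrightarrow> L"
    by (metis incseq_convergent)
  have "integrable lborel v"
  proof (rule integrable_monotone_convergence)
    show "integrable lborel (\<lambda>x. indicator (cball 0 (real i)) x *\<^sub>R v x)" for i
      using set_integrable_cball[OF v] by (simp add: set_integrable_def)
    show "AE x in lborel. mono (\<lambda>n. indicat_real (cball 0 (real n)) x *\<^sub>R v x)"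
      by (intro AE_I2 monoI) (auto simp: indicator_def v_def)
    show "AE x in lborel. (\<lambda>i. indicat_real (cball 0 (real i)) x *\<^sub>R v x) \<longlonglongrightarrow> v x"
    proof (rule AE_I2)
      fix x :: 'a
      obtain N where N: "norm x \<le> real N" using real_arch_simple by blast
      show "(\<lambda>i. indicat_real (cball 0 (real i)) x *\<^sub>R v x) \<longlonglongrightarrow> v x"
        by (rule tendsto_eventually) (use N in \<open>auto simp: eventually_sequentially indicator_def intro!:
            exI[of _ N]\<close>)
    qed
    show "(\<lambda>i. LBINT x. indicat_real (cball 0 (real i)) x *\<^sub>R v x) \<longlonglongrightarrow> L"
      using L by (simp add: P_def set_lebesgue_integral_def)
  qed simp
  then show ?thesis unfolding v_def by (rule integrable_abs_cancel) simp
qed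

lemma tendsto_integral_cball:
  fixes u :: "'a::euclidean_space \<Rightarrow> real"
  assumes "integrable lborel u"
  shows "((\<lambda>r. LINT x:cball 0 r|lborel. u x) \<longlongrightarrow> (LINT x|lborel. u x)) at_top"
  unfolding set_lebesgue_integral_def
proof (rule integral_dominated_convergence_at_top[where w="\<lambda>x. norm (u x)"])
  show "AE x in lborel. ((\<lambda>r. indicat_real (cball 0 r) x *\<^sub>R u x) \<longlongrightarrow> u x) at_top"
  proof (rule AE_I2)
    fix x :: 'a
    have "eventually (\<lambda>r. indicat_real (cball 0 r) x *\<^sub>R u x = u x) at_top"
      using eventually_ge_at_top[of "norm x"] by eventually_elim (simp add: indicator_def)
    then show "((\<lambda>r. indicat_real (cball 0 r) x *\<^sub>R u x) \<longlongrightarrow> u x) at_top"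
      by (rule tendsto_eventually)
  qed
  show "\<forall>\<^sub>F r in at_top. AE x in lborel. norm (indicat_real (cball 0 r) x *\<^sub>R u x) \<le> norm (u x)"
    by (intro always_eventually allI AE_I2) (simp add: indicator_def)
  show "(\<lambda>x. indicat_real (cball 0 r) x *\<^sub>R u x) \<in> borel_measurable lborel" for r
    by (rule borel_measurable_scaleR[OF borel_measurable_indicator borel_measurable_integrable[OF
        assms]]) simp
qed (use assms in auto)

lemma tendsto_sphere_area_integral_zero:
  fixes u :: "'a::euclidean_space \<Rightarrow> real"
  assumes u: "u \<in> borel_measurable borel" and decay: "u \<in> O[at_infinity](\<lambda>x. norm x powr s)"
    and s: "s < 1 - real DIM('a)"
  shows "((\<lambda>r. LINT x|sphere_area r. u x) \<longlongrightarrow> 0) at_top"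
proof -
  let ?n = "DIM('a)"
  obtain C b where b: "b > 0" and le: "\<And>x. norm x \<ge> b \<Longrightarrow> \<bar>u x\<bar> \<le> C * norm x powr s"
    using bigo_powr_norm_at_infinity[OF decay] by blast
  define K where "K = real ?n * unit_ball_vol ?n * C"
  show ?thesis
  proof (rule Lim_null_comparison)
    show "eventually (\<lambda>r. norm (LINT x|sphere_area r. u x) \<le> K * r powr (real ?n - 1 + s)) at_top"
      using eventually_ge_at_top[of b]
    proof eventually_elim
      case (elim r)
      then have r: "r > 0" using b by simp
      have "\<bar>LINT x|sphere_area r. u x\<bar> \<le> real ?n * unit_ball_vol ?n * r ^ (?n - 1) * (C * r powr s)"
        by (rule integral_sphere_area_le[OF u]) (use le elim r in auto)
      also have "r ^ (?n - 1) = r powr (real ?n - 1)"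
        using r by (simp add: powr_realpow[symmetric] of_nat_diff Suc_leI)
      also have "real ?n * unit_ball_vol ?n * r powr (real ?n - 1) * (C * r powr s) =
          K * (r powr (real ?n - 1) * r powr s)"
        by (simp add: K_def)
      finally show ?case by (simp add: powr_add)
    qed
    have "((\<lambda>r. r powr (real ?n - 1 + s)) \<longlongrightarrow> 0) at_top"
      using s by (intro tendsto_neg_powr filterlim_ident) simp
    then show "((\<lambda>r. K * r powr (real ?n - 1 + s)) \<longlongrightarrow> 0) at_top"
      by (rule tendsto_mult_right_zero)
  qed
qed

section \<open>The ADM flux of an asymptotically flat graph\<close>

text \<open>
  Two of the four Hessian terms produced by \<open>\<partial>\<^sub>i g\<^sub>i\<^sub>j - \<partial>\<^sub>j g\<^sub>i\<^sub>i\<close> merge, leaving the numerator of the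
  curvature field.
\<close>

lemma adm_integrand_eq:
  fixes f :: "real^'n::finite \<Rightarrow> real"
  assumes f: "smooth f"
  shows "(\<Sum>i\<in>UNIV. \<Sum>j\<in>UNIV. (partial i (\<lambda>y. graph_metric f y $ i $ j) x - partial j (\<lambda>y.
      graph_metric f y $ i $ i) x) * (x $ j / norm x))
    = (\<Sum>j\<in>UNIV. (1 + (\<Sum>s\<in>UNIV. partial s f x * partial s f x)) * curvature_field f j x * (x $ j / norm x))"
proof -
  have "(partial i (\<lambda>y. graph_metric f y $ i $ j) x - partial j (\<lambda>y. graph_metric f y $ i $ i) x) =
     partial i (partial i f) x * partial j f x - partial i (partial j f) x * partial i f x" for i j
    unfolding partial_graph_metric[OF f] using fun_cong[OF smooth_partial_commute[OF f, of i j], of x]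
        by (simp add: algebra_simps)
  moreover have "(1 + (\<Sum>s\<in>UNIV. partial s f x * partial s f x)) * curvature_field f j x =
     (\<Sum>i\<in>UNIV. partial i (partial i f) x * partial j f x - partial i (partial j f) x * partial i f x)" for j
    unfolding curvature_field_def using one_plus_sum_squares_nonzero[of "\<lambda>s. partial s f x" UNIV] by simp
  ultimately show ?thesis
    by (subst sum.swap) (simp add: sum_distrib_right sum_divide_distrib)
qed

lemma asymptotically_flat_decay:
  fixes f :: "real^'n::finite \<Rightarrow> real"
  assumes "asymptotically_flat f"
  obtains p where "p > (real CARD('n) - 2) / 2"
    "\<And>i. partial i f \<in> O[at_infinity](\<lambda>x. norm x powr (- p / 2))"
    "\<And>i j. partial j (partial i f) \<in> O[at_infinity](\<lambda>x. norm x powr (- p / 2 - 1))"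
proof -
  obtain p where p: "p > (real CARD('n) - 2) / 2"
    and d1: "\<And>i. partial i f \<in> O[at_infinity](\<lambda>x. norm x powr (- p / 2))"
    and d2: "\<And>i j k. (\<lambda>x. norm x * \<bar>partial j (partial i f) x\<bar>
                     + (norm x)\<^sup>2 * \<bar>partial k (partial j (partial i f)) x\<bar>)
                  \<in> O[at_infinity](\<lambda>x. norm x powr (- p / 2))"
    using assms unfolding asymptotically_flat_def by blast
  have "partial j (partial i f) \<in> O[at_infinity](\<lambda>x. norm x powr (- p / 2 - 1))" for i j
  proof -
    obtain C b where Cb: "C > 0" "b > 0" and le: "\<And>x. norm x \<ge> b \<Longrightarrow> \<bar>norm x * \<bar>partial j (partial i f) x\<bar>
                     + (norm x)\<^sup>2 * \<bar>partial i (partial j (partial i f)) x\<bar>\<bar> \<le> C * norm x powr (-p / 2)"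
      using bigo_powr_norm_at_infinity[OF d2] by blast
    have "\<bar>partial j (partial i f) x\<bar> \<le> C * norm x powr (- p / 2 - 1)" if x: "norm x \<ge> b" for x
    proof -
      have x0: "norm x > 0" using x Cb by linarith
      have "norm x * \<bar>partial j (partial i f) x\<bar> \<le> C * norm x powr (-p / 2)"
        using le[OF x] by (smt (verit) mult_nonneg_nonneg abs_ge_zero zero_le_power2)
      also have "norm x powr (-p/2) = norm x * norm x powr (-p/2 - 1)"
        using x0 by (simp add: powr_diff)
      finally have "norm x * \<bar>partial j (partial i f) x\<bar> \<le> norm x * (C * norm x powr (-p/2 - 1))"
          by (simp add: mult_ac)
      then show ?thesis using x0 by (simp only: mult_le_cancel_left_pos)
    qed
    then show ?thesis
      by (intro bigoI[where c=C]) (auto simp: eventually_at_infinity)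
  qed
  with p d1 that show ?thesis by blast
qed

text \<open>
  The difference between the ADM integrand and the normal component of the curvature field. It carries
  an extra factor \<open>\<bar>\<nabla>f\<bar>\<^sup>2 = O(\<bar>x\<bar> powr - p)\<close> compared with the field itself, which is \<open>O(\<bar>x\<bar> powr (- p -
  1))\<close>.
\<close>

lemma curvature_field_flux_diff_bigo:
  fixes f :: "real^'n::finite \<Rightarrow> real"
  assumes d1: "\<And>i. partial i f \<in> O[at_infinity](\<lambda>x. norm x powr (- p / 2))"
    and d2: "\<And>i j. partial j (partial i f) \<in> O[at_infinity](\<lambda>x. norm x powr (- p / 2 - 1))"
  shows "(\<lambda>x. \<Sum>j\<in>UNIV. (\<Sum>s\<in>UNIV. partial s f x * partial s f x) * curvature_field f j x * (x $ j / norm x))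
      \<in> O[at_infinity](\<lambda>x. norm x powr (- 2 * p - 1))"
proof -
  have powr: "(\<lambda>x::real^'n. norm x powr a * norm x powr b) = (\<lambda>x. norm x powr (a + b))" for a b
    by (simp add: powr_add)
  have g2: "(\<lambda>x. \<Sum>s\<in>UNIV. partial s f x * partial s f x) \<in> O[at_infinity](\<lambda>x. norm x powr (-p))"
    using landau_o.big.mult[OF d1 d1] by (intro big_sum_in_bigo) (simp add: powr)
  have num: "(\<lambda>x. \<Sum>i\<in>UNIV. partial i (partial i f) x * partial j f x - partial i (partial j f) x *
      partial i f x)
     \<in> O[at_infinity](\<lambda>x. norm x powr (-p - 1))" for j
    using landau_o.big.mult[OF d2 d1] by (intro big_sum_in_bigo sum_in_bigo) (simp_all add: powr)
  have V: "curvature_field f j \<in> O[at_infinity](\<lambda>x. norm x powr (-p - 1))" for j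
  proof -
    have "(\<lambda>x. 1 / (1 + (\<Sum>s\<in>UNIV. partial s f x * partial s f x))) \<in> O[at_infinity](\<lambda>_. 1)"
    proof (intro bigoI[where c=1] always_eventually allI)
      fix x
      have "0 \<le> (\<Sum>s\<in>UNIV. partial s f x * partial s f x)" by (simp add: sum_nonneg)
      then show "norm (1 / (1 + (\<Sum>s\<in>UNIV. partial s f x * partial s f x))) \<le> 1 * norm (1::real)" by simp
    qed
    from landau_o.big.mult[OF num this] show ?thesis by (simp add: curvature_field_def[abs_def])
  qed
  have nu: "(\<lambda>x. x $ j / norm x) \<in> O[at_infinity](\<lambda>_. 1)" for j :: 'n
  proof (intro bigoI[where c=1] always_eventually allI)
    fix x :: "real^'n"
    show "norm (x $ j / norm x) \<le> 1 * norm (1::real)"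
      using component_le_norm_cart[of x j] by (cases "x = 0") (auto simp: divide_le_eq)
  qed
  from landau_o.big.mult[OF landau_o.big.mult[OF g2 V] nu] show ?thesis
    by (intro big_sum_in_bigo) (simp add: powr)
qed

text \<open>
  On each sphere the flux is the surface integral of the curvature field, hence by the divergence
  theorem the integral of the scalar curvature over the ball, plus an error of size at most a multiple
  of \<open>r powr (n - 2 - 2 * p)\<close>. The condition \<open>p > (n - 2) / 2\<close> says exactly that this exponent is
  negative.
\<close>

lemma tendsto_adm_flux_graph_metric:
  fixes f :: "real^'n::finite \<Rightarrow> real"
  assumes f: "smooth f" and af: "asymptotically_flat f"
    and int: "integrable lborel (scalar_curvature (graph_metric f))"
  shows "(adm_flux (graph_metric f) \<longlongrightarrow>
     1 / (2 * (real CARD('n) - 1) * unit_sphere_volume TYPE(real^'n)) * (LINT x|lborel. scalar_curvature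
         (graph_metric f) x)) at_top"
proof -
  define c where "c = 1 / (2 * (real CARD('n) - 1) * unit_sphere_volume TYPE(real^'n))"
  define w where "w x = (\<Sum>s\<in>UNIV. partial s f x * partial s f x)" for x
  define V where "V = curvature_field f"
  define v where "v x = (\<Sum>j\<in>UNIV. V j x * x $ j)" for x
  define d where "d x = (\<Sum>j\<in>UNIV. w x * V j x * (x $ j / norm x))" for x
  have d_eq: "d x = w x * v x / norm x" for x
    by (simp add: d_def v_def sum_distrib_left sum_divide_distrib mult.assoc)
  have V: "continuous_on UNIV (V j)" for j unfolding V_def by (rule continuous_curvature_field[OF f])
  have w: "continuous_on UNIV w" unfolding w_def
      by (intro continuous_intros smooth_continuous smooth_partial f)
  have v: "continuous_on UNIV v" unfolding v_def by (intro continuous_intros V)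
  have wv: "continuous_on UNIV (\<lambda>x. w x * v x)" by (intro continuous_intros w v)
  have wm [measurable]: "w \<in> borel_measurable borel" using w by (rule borel_measurable_continuous_onI)
  have vm [measurable]: "v \<in> borel_measurable borel" using v by (rule borel_measurable_continuous_onI)
  have flux: "adm_flux (graph_metric f) r = c *
     ((LINT x:cball 0 r|lborel. scalar_curvature (graph_metric f) x) + (LINT x|sphere_area r.
         d x))" if r: "r > 0" for r
  proof -
    have "(LINT x|sphere_area r. (\<Sum>i\<in>UNIV. \<Sum>j\<in>UNIV. (partial i (\<lambda>y. graph_metric f y $ i $ j) x -
        partial j (\<lambda>y. graph_metric f y $ i $ i) x) * (x $ j / norm x)))
      = (LINT x|sphere_area r. (1 + w x) * v x / norm x)"
      unfolding adm_integrand_eq[OF f] w_def[symmetric] V_def[symmetric] v_def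
      by (simp add: sum_distrib_left sum_divide_distrib mult.assoc)
    also have "\<dots> = (LINT x|sphere_area r. (1 / r) * v x + (1 / r) * (w x * v x))"
      by (rule integral_sphere_area_cong) (use r in \<open>auto simp: add_divide_distrib distrib_right\<close>)
    also have "\<dots> = (1 / r) * (LINT x|sphere_area r. v x) + (1 / r) * (LINT x|sphere_area r. w x * v x)"
      by (rule integral_sphere_area_lincomb[OF v wv r])
    also have "(1 / r) * (LINT x|sphere_area r. v x) = (LINT x|sphere_area r. (1 / r) * v x)" by simp
    also have "\<dots> = (LINT x|sphere_area r. (\<Sum>j\<in>UNIV. V j x * (x $ j / norm x)))"
    proof (rule integral_sphere_area_cong)
      show "(\<lambda>x. 1 / r * v x) \<in> borel_measurable borel" by measurable
      show "(\<lambda>x. \<Sum>j\<in>UNIV. V j x * (x $ j / norm x)) \<in> borel_measurable borel"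
      proof -
        have "(\<lambda>x. v x / norm x) \<in> borel_measurable borel" by measurable
        then show ?thesis by (simp add: v_def sum_divide_distrib)
      qed
    qed (use r in \<open>auto simp: v_def sum_divide_distrib\<close>)
    also have "\<dots> = (LINT x:cball 0 r|lborel. (\<Sum>j\<in>UNIV. partial j (V j) x))"
      unfolding V_def
      by (rule divergence_theorem_ball[symmetric])
         (use r has_partial_curvature_field[OF f] continuous_curvature_field[OF f]
             continuous_partial_curvature_field[OF f] in
          \<open>auto simp: has_partial_def partial_eq[OF has_partial_curvature_field[OF f]]\<close>)
    also have "\<dots> = (LINT x:cball 0 r|lborel. scalar_curvature (graph_metric f) x)"
      by (simp add: scalar_curvature_graph_metric[OF f] V_def)
    also have "(1 / r) * (LINT x|sphere_area r. w x * v x) = (LINT x|sphere_area r. (1 / r) * (w x *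
        v x))" by simp
    also have "\<dots> = (LINT x|sphere_area r. d x)"
      unfolding d_eq by (rule integral_sphere_area_cong) (use r in auto)
    finally show ?thesis unfolding adm_flux_def c_def by simp
  qed
  obtain p where p: "p > (real CARD('n) - 2) / 2"
    and d1: "\<And>i. partial i f \<in> O[at_infinity](\<lambda>x. norm x powr (- p / 2))"
    and d2: "\<And>i j. partial j (partial i f) \<in> O[at_infinity](\<lambda>x. norm x powr (- p / 2 - 1))"
    using asymptotically_flat_decay[OF af] by blast
  have "((\<lambda>r. LINT x|sphere_area r. d x) \<longlongrightarrow> 0) at_top"
  proof (rule tendsto_sphere_area_integral_zero)
    show "d \<in> O[at_infinity](\<lambda>x. norm x powr (- 2 * p - 1))"
      using curvature_field_flux_diff_bigo[OF d1 d2] by (simp add: d_def[abs_def] w_def V_def)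
    show "- 2 * p - 1 < 1 - real DIM(real^'n)" using p by (simp add: field_simps)
  qed (simp add: d_eq[abs_def])
  with tendsto_integral_cball[OF int]
  have "((\<lambda>r. c * ((LINT x:cball 0 r|lborel. scalar_curvature (graph_metric f) x) +
      (LINT x|sphere_area r. d x)))
      \<longlongrightarrow> c * ((LINT x|lborel. scalar_curvature (graph_metric f) x) + 0)) at_top"
    by (intro tendsto_mult_left tendsto_add)
  moreover have "eventually (\<lambda>r. c * ((LINT x:cball 0 r|lborel. scalar_curvature (graph_metric f) x) +
      (LINT x|sphere_area r. d x))
      = adm_flux (graph_metric f) r) at_top"
    using eventually_gt_at_top[of "0::real"] by eventually_elim (simp only: flux)
  ultimately have "(adm_flux (graph_metric f) \<longlongrightarrow> c * ((LINT x|lborel.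
      scalar_curvature (graph_metric f) x) + 0)) at_top"
    by (rule Lim_transform_eventually)
  then show ?thesis by (simp only: c_def add_0_right)
qed

theorem theorem5:
  fixes f :: "real^'n::finite \<Rightarrow> real" and q :: real
  assumes "CARD('n) \<ge> 3"
    and "smooth f"
    and "asymptotically_flat f"
    and "q > real CARD('n)"
    and "(\<lambda>x. \<bar>scalar_curvature (graph_metric f) x\<bar>) \<in> O[at_infinity](\<lambda>x. norm x powr (- q))"
  shows "(adm_flux (graph_metric f) \<longlongrightarrow> adm_mass (graph_metric f)) at_top
    \<and> integrable (riemannian_volume (graph_metric f))
        (\<lambda>x. scalar_curvature (graph_metric f) x * (1 / sqrt (1 + (norm (grad f x))\<^sup>2)))
    \<and> adm_mass (graph_metric f) =
        1 / (2 * (real CARD('n) - 1) * unit_sphere_volume TYPE(real^'n)) *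
        (LINT x|riemannian_volume (graph_metric f).
           scalar_curvature (graph_metric f) x * (1 / sqrt (1 + (norm (grad f x))\<^sup>2)))
    \<and> ((\<forall>x. scalar_curvature (graph_metric f) x \<ge> 0) \<longrightarrow> adm_mass (graph_metric f) \<ge> 0)"
proof -
  let ?R = "scalar_curvature (graph_metric f)"
  let ?c = "1 / (2 * (real CARD('n) - 1) * unit_sphere_volume TYPE(real^'n))"
  let ?\<rho> = "\<lambda>x. sqrt (1 + (norm (grad f x))\<^sup>2)"
  have contR: "continuous_on UNIV ?R"
    using continuous_partial_curvature_field[OF assms(2)]
    by (auto simp: scalar_curvature_graph_metric[OF assms(2), abs_def] intro!: continuous_intros)
  have Rm [measurable]: "?R \<in> borel_measurable borel" using contR by (rule borel_measurable_continuous_onI)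
  have int: "integrable lborel ?R"
    by (rule integrable_bigo_powr_norm[OF contR]) (use assms in \<open>simp_all add: landau_o.big.abs_in_iff\<close>)
  have "continuous_on UNIV ?\<rho>"
    unfolding norm_grad by (intro continuous_intros smooth_continuous smooth_partial assms)
  then have \<rho>m [measurable]: "?\<rho> \<in> borel_measurable borel" by (rule borel_measurable_continuous_onI)
  have vol: "riemannian_volume (graph_metric f) = density lborel (\<lambda>x. ennreal (?\<rho> x))"
    unfolding riemannian_volume_def graph_metric_eq det_rank_one_update by (simp add: power2_norm_eq_inner)
  have \<rho>: "?\<rho> x > 0" for x by (simp add: add_pos_nonneg)
  have cancel: "?\<rho> x * (?R x * (1 / ?\<rho> x)) = ?R x" for x
    using \<rho>[of x] by simp
  have m: "(\<lambda>x. ?R x * (1 / ?\<rho> x)) \<in> borel_measurable lborel" "?\<rho> \<in> borel_measurable lborel" by measurable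
  have nn: "AE x in lborel. 0 \<le> ?\<rho> x" using less_imp_le[OF \<rho>] by (intro AE_I2)
  have int': "integrable (riemannian_volume (graph_metric f)) (\<lambda>x. ?R x * (1 / ?\<rho> x))"
    unfolding vol integrable_density[OF m nn] real_scaleR_def cancel by (rule int)
  have eq: "(LINT x|riemannian_volume (graph_metric f). ?R x * (1 / ?\<rho> x)) = (LINT x|lborel. ?R x)"
    unfolding vol integral_density[OF m nn] real_scaleR_def cancel ..
  have lim: "(adm_flux (graph_metric f) \<longlongrightarrow> ?c * (LINT x|lborel. ?R x)) at_top"
    by (rule tendsto_adm_flux_graph_metric[OF assms(2,3) int])
  then have mass: "adm_mass (graph_metric f) = ?c * (LINT x|lborel. ?R x)"
    unfolding adm_mass_def by (intro tendsto_Lim) auto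
  have "?c \<ge> 0" using assms(1) by (simp add: unit_sphere_volume_def)
  then have "adm_mass (graph_metric f) \<ge> 0" if "\<forall>x. ?R x \<ge> 0"
    unfolding mass using that by (intro mult_nonneg_nonneg integral_nonneg_AE) auto
  with lim mass int' eq show ?thesis by simp
qed

end
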